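(* Let $(M,L)$ be a Finsler manifold and let $\overline{L}(x,y)=e^{\sigma(x)}L(x,y)+\beta(x,y)$, $\beta=b_i(x)y^i$, be a $\beta$-conformal change of $L$. Then the Cartan connection coefficients $\overline{\Gamma}^i_{jk}$ of $(M,\overline{L})$ and $\Gamma^i_{jk}$ of $(M,L)$ are related by $\overline{\Gamma}^i_{jk}=\Gamma^i_{jk}+D^i_{jk}$, where $$D^i_{jk}=L H^i{}_{jk}+\frac{L}{\overline{L}}\,(H_{jk}-L H_{\beta jk})\,L^i ,\qquad H^i{}_{jk}=g^{ir}H_{rjk},\quad H_{\beta jk}=b^iH_{ijk},$$ and the ingredients are given explicitly in terms of $L,\sigma,\beta$ as follows: $$H_{ijk}=\tfrac12\big(L_{jkr}D^r_{0i}-L_{ijr}D^r_{0k}-L_{ikr}D^r_{0j}+\sigma_jL_{ik}+\sigma_kL_{ij}-\sigma_iL_{jk}\big),$$ $$H_{ij}=E_{ij}-\tfrac12 e^{\sigma}\big(L_{ir}D^r_{0j}+L_{jr}D^r_{0i}-\sigma_{ij}\big),$$ $$D^i_{0j}=L\,G^i{}_j+\frac{L}{\overline{L}}\,(G_j-L G_{\beta j})\,L^i,\qquad G^i{}_j=g^{ir}G_{rj},\quad G_{\beta j}=b^iG_{ij},$$ $$G_{ij}=e^{-\sigma}F_{ij}-\tfrac12 L_{ijr}D^r_{00}+\tfrac12(\sigma_0L_{ij}-\mu_{ij}),$$ $$G_i=E_{0i}-\tfrac12 e^{\sigma}L_{ir}D^r_{00}+\tfrac12 e^{\sigma}(\sigma_0L_i+\sigma_iL),$$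 $$D^r_{00}=2Le^{-\sigma}F^r_0+\frac{L}{\overline{L}}\,(E_{00}-2Le^{-\sigma}F_{\beta0})L^r-L^2\sigma^r+\frac{L}{\overline{L}}\,(2Le^{\sigma}\sigma_0+L^2\sigma_\beta)L^r .$$ (Here $D^i_{0j}=D^i_{kj}y^k$ and $D^r_{00}=D^r_{jk}y^jy^k$.)
   Context: $M$ is an $n$-dimensional $C^\infty$ manifold, $L(x,y)$ a Finsler metric function; all objects are considered in local coordinates $(x^i,y^i)$ at $y\neq0$. A $\beta$-conformal change is $L\to\overline{L}=e^{\sigma}L+\beta$, with $\sigma$ a smooth function on $M$ and $\beta=b_i(x)y^i$ a 1-form on $M$; $\overline{L}$ is assumed to be a Finsler metric function too. $\partial_i=\partial/\partial x^i$, $\dot\partial_i=\partial/\partial y^i$; summation convention; the index $0$ denotes contraction with $y$ (e.g. $F_{i0}=F_{ij}y^j$, $E_{0i}=E_{ji}y^j$, $\sigma_0=\sigma_jy^j$). Notation for $(M,L)$: $g_{ij}=\frac12\dot\partial_i\dot\partial_jL^2$ with inverse $g^{ij}$; $L_i=\dot\partial_iL$, $L^i=y^i/L$; $L_{ij}=\dot\partial_jL_i$, $L_{ijk}=\dot\partial_kL_{ij}$. Cartan connection: $N^i_j=\frac12\dot\partial_jS^i$ with $S^i=\frac12g^{ir}(y^k\partial_k\dot\partial_rL^2-\partial_rL^2)$, $\delta_k=\partial_k-N^r_k\dot\partial_r$, $\Gamma^i_{jk}=\frac12g^{ir}(\delta_jg_{rk}+\delta_kg_{rj}-\delta_rg_{jk})$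 (symmetric in $j,k$, with $y^k\Gamma^i_{jk}=N^i_j$). Bars denote the same objects built from $\overline{L}$. The $h$-covariant derivative of $b_i$ is $b_{i|j}=\delta_jb_i-b_r\Gamma^r_{ij}$. Further: $\sigma_i=\partial_i\sigma$, $\sigma^r=g^{ri}\sigma_i$, $b^i=g^{ij}b_j$, $\sigma_\beta=\sigma_ib^i$, $E_{ij}=\frac12(b_{i|j}+b_{j|i})$, $F_{ij}=\frac12(b_{i|j}-b_{j|i})$, $F^r_0=g^{ir}F_{i0}$, $F_{\beta0}=F_{i0}b^i$, $\sigma_{ij}=\sigma_iL_j+\sigma_jL_i$, $\mu_{ij}=\sigma_iL_j-\sigma_jL_i$. *)

theory Defs
  imports "HOL-Analysis.Analysis"
begin

section \<open>Smooth functions\<close>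

primrec higher_differentiable_on ::
  "'a::real_normed_vector set \<Rightarrow> ('a \<Rightarrow> 'b::real_normed_vector) \<Rightarrow> nat \<Rightarrow> bool" where
  "higher_differentiable_on S f 0 \<longleftrightarrow> continuous_on S f"
| "higher_differentiable_on S f (Suc n) \<longleftrightarrow>
     (\<forall>x\<in>S. f differentiable at x) \<and>
     (\<forall>v. higher_differentiable_on S (\<lambda>x. frechet_derivative f (at x) v) n)"

(* Meant for open S and finite-dimensional domains. *)
definition smooth_on :: "'a::real_normed_vector set \<Rightarrow> ('a \<Rightarrow> 'b::real_normed_vector) \<Rightarrow> bool" where
  "smooth_on S f \<longleftrightarrow> (\<forall>n. higher_differentiable_on S f n)"

definition pd :: "'n::finite \<Rightarrow> (real^'n \<Rightarrow> real) \<Rightarrow> real^'n \<Rightarrow> real" where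
  "pd i f x = frechet_derivative f (at x) (axis i 1)"


section \<open>Manifolds, tangent vectors, Finsler metric functions\<close>

type_synonym ('m, 'n) chart = "'m set \<times> ('m \<Rightarrow> real^'n)"

definition chart_image :: "('m, 'n::finite) chart \<Rightarrow> (real^'n) set" where
  "chart_image c = snd c ` fst c"

definition chart_inv :: "('m, 'n::finite) chart \<Rightarrow> real^'n \<Rightarrow> 'm" where
  "chart_inv c = inv_into (fst c) (snd c)"

(* Any atlas is allowed, in particular the maximal one. *)
definition smooth_atlas :: "('m::topological_space, 'n::finite) chart set \<Rightarrow> bool" where
  "smooth_atlas A \<longleftrightarrow>
     (\<Union>c\<in>A. fst c) = UNIV \<and>
     (\<forall>c\<in>A. open (fst c) \<and> open (chart_image c) \<and>
            homeomorphism (fst c) (chart_image c) (snd c) (chart_inv c)) \<and>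
     (\<forall>c\<in>A. \<forall>d\<in>A. smooth_on (snd c ` (fst c \<inter> fst d)) (snd d \<circ> chart_inv c))"

definition smooth_fun :: "('m, 'n::finite) chart set \<Rightarrow> ('m \<Rightarrow> real) \<Rightarrow> bool" where
  "smooth_fun A f \<longleftrightarrow> (\<forall>c\<in>A. smooth_on (chart_image c) (f \<circ> chart_inv c))"

(* A tangent vector is the derivation it induces on smooth functions, extended by 0 to all
   other functions. *)
type_synonym 'm tvec = "('m \<Rightarrow> real) \<Rightarrow> real"

(* The tangent vector with components y^i in the chart c at the point with coordinates x^i. *)
definition coord_vec ::
  "('m, 'n::finite) chart set \<Rightarrow> ('m, 'n) chart \<Rightarrow> real^'n \<Rightarrow> real^'n \<Rightarrow> 'm tvec" where
  "coord_vec A c x y =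
     (\<lambda>f. if smooth_fun A f then (\<Sum>i\<in>UNIV. y $ i * pd i (f \<circ> chart_inv c) x) else 0)"

(* The expression, in the coordinates (x^i, y^i) induced by c, of a function on the tangent
   bundle.  Functions on the tangent bundle take the base point and the vector; their values at
   (p, v) with v not tangent at p are irrelevant. *)
definition local_rep ::
  "('m, 'n::finite) chart set \<Rightarrow> ('m, 'n) chart \<Rightarrow> ('m \<Rightarrow> 'm tvec \<Rightarrow> real)
     \<Rightarrow> real^'n \<Rightarrow> real^'n \<Rightarrow> real" where
  "local_rep A c F x y = F (chart_inv c x) (coord_vec A c x y)"

definition form_comp ::
  "('m, 'n::finite) chart set \<Rightarrow> ('m, 'n) chart \<Rightarrow> ('m \<Rightarrow> 'm tvec \<Rightarrow> real)
     \<Rightarrow> real^'n \<Rightarrow> real^'n" where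
  "form_comp A c \<beta> x = (\<chi> i. local_rep A c \<beta> x (axis i 1))"

definition one_form :: "('m, 'n::finite) chart set \<Rightarrow> ('m \<Rightarrow> 'm tvec \<Rightarrow> real) \<Rightarrow> bool" where
  "one_form A \<beta> \<longleftrightarrow>
     (\<forall>c\<in>A. smooth_on (chart_image c) (form_comp A c \<beta>) \<and>
       (\<forall>x\<in>chart_image c. \<forall>y.
          local_rep A c \<beta> x y = (\<Sum>i\<in>UNIV. form_comp A c \<beta> x $ i * y $ i)))"

(* A function of local coordinates (x, y). *)
type_synonym 'n field = "real^'n \<Rightarrow> real^'n \<Rightarrow> real"

definition dx :: "'n::finite \<Rightarrow> 'n field \<Rightarrow> 'n field" where
  "dx i f x y = pd i (\<lambda>x'. f x' y) x"

definition dy :: "'n::finite \<Rightarrow> 'n field \<Rightarrow> 'n field" where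
  "dy i f x y = pd i (f x) y"

definition fund :: "'n::finite field \<Rightarrow> 'n \<Rightarrow> 'n \<Rightarrow> 'n field" where
  "fund L i j x y = 1/2 * dy i (dy j (\<lambda>x y. (L x y)\<^sup>2)) x y"

definition finsler_metric ::
  "('m, 'n::finite) chart set \<Rightarrow> ('m \<Rightarrow> 'm tvec \<Rightarrow> real) \<Rightarrow> bool" where
  "finsler_metric A F \<longleftrightarrow>
     (\<forall>c\<in>A. let L = local_rep A c F; X = chart_image c in
        smooth_on (X \<times> (UNIV - {0})) (\<lambda>(x, y). L x y) \<and>
        (\<forall>x\<in>X. \<forall>y. \<forall>t>0. L x (t *\<^sub>R y) = t * L x y) \<and>
        (\<forall>x\<in>X. \<forall>y. y \<noteq> 0 \<longrightarrow> L x y > 0) \<and>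
        (\<forall>x\<in>X. \<forall>y. y \<noteq> 0 \<longrightarrow>
           (\<forall>v. v \<noteq> 0 \<longrightarrow> (\<Sum>i\<in>UNIV. \<Sum>j\<in>UNIV. fund L i j x y * v $ i * v $ j) > 0)))"

definition beta_change ::
  "('m \<Rightarrow> real) \<Rightarrow> ('m \<Rightarrow> 'm tvec \<Rightarrow> real) \<Rightarrow> ('m \<Rightarrow> 'm tvec \<Rightarrow> real) \<Rightarrow> ('m \<Rightarrow> 'm tvec \<Rightarrow> real)" where
  "beta_change \<sigma> \<beta> L = (\<lambda>p v. exp (\<sigma> p) * L p v + \<beta> p v)"


section \<open>Cartan connection\<close>

text \<open>
  In the following, \<open>L\<close> is a function of local coordinates \<open>(x, y)\<close>. The arguments following
  \<open>L\<close> (and \<open>\<sigma>\<close>, \<open>b\<close>) are the indices in the order of the usual notation, upper index first.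
\<close>

definition fund_inv :: "'n::finite field \<Rightarrow> 'n \<Rightarrow> 'n \<Rightarrow> 'n field" where
  "fund_inv L i j x y = matrix_inv (\<chi> i j. fund L i j x y) $ i $ j"

definition spray :: "'n::finite field \<Rightarrow> 'n \<Rightarrow> 'n field" where
  "spray L i x y = 1/2 * (\<Sum>r\<in>UNIV. fund_inv L i r x y *
     ((\<Sum>k\<in>UNIV. y $ k * dx k (dy r (\<lambda>x y. (L x y)\<^sup>2)) x y) - dx r (\<lambda>x y. (L x y)\<^sup>2) x y))"

definition nonlin :: "'n::finite field \<Rightarrow> 'n \<Rightarrow> 'n \<Rightarrow> 'n field" where
  "nonlin L i j x y = 1/2 * dy j (spray L i) x y"

definition delta :: "'n::finite field \<Rightarrow> 'n \<Rightarrow> 'n field \<Rightarrow> 'n field" where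
  "delta L k f x y = dx k f x y - (\<Sum>r\<in>UNIV. nonlin L r k x y * dy r f x y)"

definition cartan :: "'n::finite field \<Rightarrow> 'n \<Rightarrow> 'n \<Rightarrow> 'n \<Rightarrow> 'n field" where
  "cartan L i j k x y = 1/2 * (\<Sum>r\<in>UNIV. fund_inv L i r x y *
     (delta L j (fund L r k) x y + delta L k (fund L r j) x y - delta L r (fund L j k) x y))"

definition L1 :: "'n::finite field \<Rightarrow> 'n \<Rightarrow> 'n field" where
  "L1 L i = dy i L"

definition L2 :: "'n::finite field \<Rightarrow> 'n \<Rightarrow> 'n \<Rightarrow> 'n field" where
  "L2 L i j = dy j (L1 L i)"

definition L3 :: "'n::finite field \<Rightarrow> 'n \<Rightarrow> 'n \<Rightarrow> 'n \<Rightarrow> 'n field" where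
  "L3 L i j k = dy k (L2 L i j)"

definition Lup :: "'n::finite field \<Rightarrow> 'n \<Rightarrow> 'n field" where
  "Lup L i x y = y $ i / L x y"


section \<open>The difference tensor of a beta-conformal change\<close>

type_synonym 'n base_fun = "real^'n \<Rightarrow> real"
type_synonym 'n base_form = "real^'n \<Rightarrow> real^'n"

definition b_cov :: "'n::finite field \<Rightarrow> 'n base_form \<Rightarrow> 'n \<Rightarrow> 'n \<Rightarrow> 'n field" where
  "b_cov L b i j x y = delta L j (\<lambda>x y. b x $ i) x y - (\<Sum>r\<in>UNIV. b x $ r * cartan L r i j x y)"

definition b_up :: "'n::finite field \<Rightarrow> 'n base_form \<Rightarrow> 'n \<Rightarrow> 'n field" where
  "b_up L b i x y = (\<Sum>j\<in>UNIV. fund_inv L i j x y * b x $ j)"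

definition sigma_up :: "'n::finite field \<Rightarrow> 'n base_fun \<Rightarrow> 'n \<Rightarrow> 'n field" where
  "sigma_up L \<sigma> r x y = (\<Sum>i\<in>UNIV. fund_inv L r i x y * pd i \<sigma> x)"

definition sigma_beta :: "'n::finite field \<Rightarrow> 'n base_fun \<Rightarrow> 'n base_form \<Rightarrow> 'n field" where
  "sigma_beta L \<sigma> b x y = (\<Sum>i\<in>UNIV. pd i \<sigma> x * b_up L b i x y)"

definition sigma0 :: "'n::finite base_fun \<Rightarrow> 'n field" where
  "sigma0 \<sigma> x y = (\<Sum>j\<in>UNIV. pd j \<sigma> x * y $ j)"

definition sigma2 :: "'n::finite field \<Rightarrow> 'n base_fun \<Rightarrow> 'n \<Rightarrow> 'n \<Rightarrow> 'n field" where
  "sigma2 L \<sigma> i j x y = pd i \<sigma> x * L1 L j x y + pd j \<sigma> x * L1 L i x y"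

definition mu :: "'n::finite field \<Rightarrow> 'n base_fun \<Rightarrow> 'n \<Rightarrow> 'n \<Rightarrow> 'n field" where
  "mu L \<sigma> i j x y = pd i \<sigma> x * L1 L j x y - pd j \<sigma> x * L1 L i x y"

definition E :: "'n::finite field \<Rightarrow> 'n base_form \<Rightarrow> 'n \<Rightarrow> 'n \<Rightarrow> 'n field" where
  "E L b i j x y = 1/2 * (b_cov L b i j x y + b_cov L b j i x y)"

definition F :: "'n::finite field \<Rightarrow> 'n base_form \<Rightarrow> 'n \<Rightarrow> 'n \<Rightarrow> 'n field" where
  "F L b i j x y = 1/2 * (b_cov L b i j x y - b_cov L b j i x y)"

(* E_{0i} *)
definition E0 :: "'n::finite field \<Rightarrow> 'n base_form \<Rightarrow> 'n \<Rightarrow> 'n field" where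
  "E0 L b i x y = (\<Sum>j\<in>UNIV. E L b j i x y * y $ j)"

definition E00 :: "'n::finite field \<Rightarrow> 'n base_form \<Rightarrow> 'n field" where
  "E00 L b x y = (\<Sum>i\<in>UNIV. \<Sum>j\<in>UNIV. E L b i j x y * y $ i * y $ j)"

(* F_{i0} *)
definition F0 :: "'n::finite field \<Rightarrow> 'n base_form \<Rightarrow> 'n \<Rightarrow> 'n field" where
  "F0 L b i x y = (\<Sum>j\<in>UNIV. F L b i j x y * y $ j)"

(* F^r_0 *)
definition F0_up :: "'n::finite field \<Rightarrow> 'n base_form \<Rightarrow> 'n \<Rightarrow> 'n field" where
  "F0_up L b r x y = (\<Sum>i\<in>UNIV. fund_inv L i r x y * F0 L b i x y)"

definition F_beta0 :: "'n::finite field \<Rightarrow> 'n base_form \<Rightarrow> 'n field" where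
  "F_beta0 L b x y = (\<Sum>i\<in>UNIV. F0 L b i x y * b_up L b i x y)"

definition Lbar :: "'n::finite field \<Rightarrow> 'n base_fun \<Rightarrow> 'n base_form \<Rightarrow> 'n field" where
  "Lbar L \<sigma> b x y = exp (\<sigma> x) * L x y + (\<Sum>i\<in>UNIV. b x $ i * y $ i)"

(* D^r_{00} *)
definition D00 :: "'n::finite field \<Rightarrow> 'n base_fun \<Rightarrow> 'n base_form \<Rightarrow> 'n \<Rightarrow> 'n field" where
  "D00 L \<sigma> b r x y =
     2 * L x y * exp (- \<sigma> x) * F0_up L b r x y
     + L x y / Lbar L \<sigma> b x y * (E00 L b x y - 2 * L x y * exp (- \<sigma> x) * F_beta0 L b x y) * Lup L r x y
     - (L x y)\<^sup>2 * sigma_up L \<sigma> r x y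
     + L x y / Lbar L \<sigma> b x y *
         (2 * L x y * exp (\<sigma> x) * sigma0 \<sigma> x y + (L x y)\<^sup>2 * sigma_beta L \<sigma> b x y) * Lup L r x y"

(* G_i *)
definition G1 :: "'n::finite field \<Rightarrow> 'n base_fun \<Rightarrow> 'n base_form \<Rightarrow> 'n \<Rightarrow> 'n field" where
  "G1 L \<sigma> b i x y =
     E0 L b i x y
     - 1/2 * exp (\<sigma> x) * (\<Sum>r\<in>UNIV. L2 L i r x y * D00 L \<sigma> b r x y)
     + 1/2 * exp (\<sigma> x) * (sigma0 \<sigma> x y * L1 L i x y + pd i \<sigma> x * L x y)"

(* G_{ij} *)
definition G2 :: "'n::finite field \<Rightarrow> 'n base_fun \<Rightarrow> 'n base_form \<Rightarrow> 'n \<Rightarrow> 'n \<Rightarrow> 'n field" where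
  "G2 L \<sigma> b i j x y =
     exp (- \<sigma> x) * F L b i j x y
     - 1/2 * (\<Sum>r\<in>UNIV. L3 L i j r x y * D00 L \<sigma> b r x y)
     + 1/2 * (sigma0 \<sigma> x y * L2 L i j x y - mu L \<sigma> i j x y)"

definition G2_up :: "'n::finite field \<Rightarrow> 'n base_fun \<Rightarrow> 'n base_form \<Rightarrow> 'n \<Rightarrow> 'n \<Rightarrow> 'n field" where
  "G2_up L \<sigma> b i j x y = (\<Sum>r\<in>UNIV. fund_inv L i r x y * G2 L \<sigma> b r j x y)"

definition G_beta :: "'n::finite field \<Rightarrow> 'n base_fun \<Rightarrow> 'n base_form \<Rightarrow> 'n \<Rightarrow> 'n field" where
  "G_beta L \<sigma> b j x y = (\<Sum>i\<in>UNIV. b_up L b i x y * G2 L \<sigma> b i j x y)"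

(* D^i_{0j} *)
definition D0 :: "'n::finite field \<Rightarrow> 'n base_fun \<Rightarrow> 'n base_form \<Rightarrow> 'n \<Rightarrow> 'n \<Rightarrow> 'n field" where
  "D0 L \<sigma> b i j x y =
     L x y * G2_up L \<sigma> b i j x y
     + L x y / Lbar L \<sigma> b x y * (G1 L \<sigma> b j x y - L x y * G_beta L \<sigma> b j x y) * Lup L i x y"

(* H_{ij} *)
definition H2 :: "'n::finite field \<Rightarrow> 'n base_fun \<Rightarrow> 'n base_form \<Rightarrow> 'n \<Rightarrow> 'n \<Rightarrow> 'n field" where
  "H2 L \<sigma> b i j x y =
     E L b i j x y
     - 1/2 * exp (\<sigma> x) *
         ((\<Sum>r\<in>UNIV. L2 L i r x y * D0 L \<sigma> b r j x y)
          + (\<Sum>r\<in>UNIV. L2 L j r x y * D0 L \<sigma> b r i x y)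
          - sigma2 L \<sigma> i j x y)"

(* H_{ijk} *)
definition H3 :: "'n::finite field \<Rightarrow> 'n base_fun \<Rightarrow> 'n base_form \<Rightarrow> 'n \<Rightarrow> 'n \<Rightarrow> 'n \<Rightarrow> 'n field" where
  "H3 L \<sigma> b i j k x y = 1/2 *
     ((\<Sum>r\<in>UNIV. L3 L j k r x y * D0 L \<sigma> b r i x y)
      - (\<Sum>r\<in>UNIV. L3 L i j r x y * D0 L \<sigma> b r k x y)
      - (\<Sum>r\<in>UNIV. L3 L i k r x y * D0 L \<sigma> b r j x y)
      + pd j \<sigma> x * L2 L i k x y + pd k \<sigma> x * L2 L i j x y - pd i \<sigma> x * L2 L j k x y)"

definition H3_up :: "'n::finite field \<Rightarrow> 'n base_fun \<Rightarrow> 'n base_form \<Rightarrow> 'n \<Rightarrow> 'n \<Rightarrow> 'n \<Rightarrow> 'n field" where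
  "H3_up L \<sigma> b i j k x y = (\<Sum>r\<in>UNIV. fund_inv L i r x y * H3 L \<sigma> b r j k x y)"

definition H_beta :: "'n::finite field \<Rightarrow> 'n base_fun \<Rightarrow> 'n base_form \<Rightarrow> 'n \<Rightarrow> 'n \<Rightarrow> 'n field" where
  "H_beta L \<sigma> b j k x y = (\<Sum>i\<in>UNIV. b_up L b i x y * H3 L \<sigma> b i j k x y)"

(* D^i_{jk} *)
definition D :: "'n::finite field \<Rightarrow> 'n base_fun \<Rightarrow> 'n base_form \<Rightarrow> 'n \<Rightarrow> 'n \<Rightarrow> 'n \<Rightarrow> 'n field" where
  "D L \<sigma> b i j k x y =
     L x y * H3_up L \<sigma> b i j k x y
     + L x y / Lbar L \<sigma> b x y * (H2 L \<sigma> b j k x y - L x y * H_beta L \<sigma> b j k x y) * Lup L i x y"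

end

(*
  In the notation of the paper, write D for the difference of the two Cartan connections.  The
  h-covariant derivatives of L_i and L_ij vanish for the Cartan connection of L, and likewise those of
  the changed metric, for which Lbar_i = e^sigma L_i + b_i and Lbar_ij = e^sigma L_ij.  Comparing the
  two sets of equations expresses L_jr D^r_ik + L_ir D^r_jk and Lbar_r D^r_ij in terms of D^r_0k;
  Christoffel's trick turns the first into L_ir D^r_jk = H_ijk, and symmetrizing the second gives
  Lbar_r D^r_jk = H_jk.  Contracting with y once and twice gives equations of the same shape
  for D^r_0j and D^r_00.  Each of these linear systems has a unique solution, because
  g_ij = L_i L_j + L L_ij is invertible.
*)

theory Submission
  imports Defs
begin

section \<open>Higher differentiability\<close>

text \<open>Contraction with y alone does not close the systems. Contracting the equation from
  Christoffel's trick yields only the sum L_ir D^r_0j + L_jr D^r_0i, which leaves L_ir D^r_0j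
  undetermined. The missing difference comes from the antisymmetric part of the equation for Lbar_r
  D^r_ij, where the left side cancels and F_ij appears. A second contraction removes the remaining
  unknowns: by homogeneity L_ij y^j = 0 and L_ijr y^j = -L_ir, so D^r_00 stands alone and the
  systems are solved in the order D_00, D_0j, D_jk.

  That L_i and L_ij are h-parallel has to be derived from definitions in which the spray S, N and
  Gamma contain the inverse matrix of g. Products with g are free of the inverse, so identities
  between S, N and Gamma are compared after lowering the index. Differentiating S in y still
  requires its differentiability, which Cramer's rule provides.\<close>

text \<open>The definition differentiates a function on the whole space, while sum and product rules
  give the derivative only at points of S. For open S this congruence carries such pointwise
  formulas through the recursion.\<close>

lemma higher_differentiable_on_cong:
  assumes "open S" and "\<And>x. x \<in> S \<Longrightarrow> f x = g x"
  shows "higher_differentiable_on S f n \<longleftrightarrow> higher_differentiable_on S g n"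
  using assms(2)
proof (induction n arbitrary: f g)
  case 0
  then show ?case by (simp cong: continuous_on_cong)
next
  case (Suc n)
  have d: "f differentiable at x \<longleftrightarrow> g differentiable at x" if "x \<in> S" for x
    using that Suc.prems assms(1) unfolding differentiable_def
    by (metis has_derivative_transform_within_open)
  have e: "frechet_derivative f (at x) v = frechet_derivative g (at x) v" if "x \<in> S" for x v
  proof -
    have "(f has_derivative f') (at x) \<longleftrightarrow> (g has_derivative f') (at x)" for f'
      using has_derivative_transform_within_open[OF _ assms(1) that, of f f' UNIV g]
        has_derivative_transform_within_open[OF _ assms(1) that, of g f' UNIV f] Suc.prems by auto
    then show ?thesis by (simp add: frechet_derivative_def)
  qed
  show ?case
    using d Suc.IH[of "\<lambda>x. frechet_derivative f (at x) v" "\<lambda>x. frechet_derivative g (at x) v" for v] e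
    by simp
qed

lemma higher_differentiable_on_continuous:
  assumes "higher_differentiable_on S f n"
  shows "continuous_on S f"
  using assms
  by (cases n) (auto intro!: differentiable_imp_continuous_on differentiable_at_imp_differentiable_on)

lemma higher_differentiable_on_lower:
  "higher_differentiable_on S f (Suc n) \<Longrightarrow> higher_differentiable_on S f n"
proof (induction n arbitrary: f)
  case 0
  then show ?case
    by (metis higher_differentiable_on_continuous higher_differentiable_on.simps(1))
next
  case (Suc n)
  show ?case
    using Suc.prems Suc.IH unfolding higher_differentiable_on.simps(2)[of S f] by blast
qed

lemma higher_differentiable_on_const: "higher_differentiable_on S (\<lambda>x. c) n"
  by (induction n arbitrary: c) (simp_all add: frechet_derivative_const)

lemma higher_differentiable_on_add:
  assumes "open S" "higher_differentiable_on S f n" "higher_differentiable_on S g n"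
  shows "higher_differentiable_on S (\<lambda>x. f x + g x) n"
  using assms(2,3)
proof (induction n arbitrary: f g)
  case 0
  then show ?case by (simp add: continuous_on_add)
next
  case (Suc n)
  have "higher_differentiable_on S (\<lambda>x. frechet_derivative (\<lambda>x. f x + g x) (at x) v) n" for v
  proof -
    have "frechet_derivative (\<lambda>x. f x + g x) (at x) v
      = frechet_derivative f (at x) v + frechet_derivative g (at x) v" if "x \<in> S" for x
    proof -
      have "((\<lambda>x. f x + g x) has_derivative
        (\<lambda>v. frechet_derivative f (at x) v + frechet_derivative g (at x) v)) (at x)"
        using Suc.prems that by (intro has_derivative_add) (simp_all flip: frechet_derivative_works)
      from frechet_derivative_at[OF this] show ?thesis by (simp add: fun_eq_iff)
    qed
    moreover have "higher_differentiable_on S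
      (\<lambda>x. frechet_derivative f (at x) v + frechet_derivative g (at x) v) n"
      using Suc by simp
    ultimately show ?thesis
      using higher_differentiable_on_cong[OF assms(1)] by (metis (no_types, lifting))
  qed
  then show ?case using Suc.prems by simp
qed

lemma higher_differentiable_on_mult:
  fixes f g :: "'a::real_normed_vector \<Rightarrow> real"
  assumes "open S" "higher_differentiable_on S f n" "higher_differentiable_on S g n"
  shows "higher_differentiable_on S (\<lambda>x. f x * g x) n"
  using assms(2,3)
proof (induction n arbitrary: f g)
  case 0
  then show ?case by (simp add: continuous_on_mult)
next
  case (Suc n)
  have "higher_differentiable_on S (\<lambda>x. frechet_derivative (\<lambda>x. f x * g x) (at x) v) n" for v
  proof -
    have "frechet_derivative (\<lambda>x. f x * g x) (at x) v
      = f x * frechet_derivative g (at x) v + frechet_derivative f (at x) v * g x" if "x \<in> S" for x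
    proof -
      have "((\<lambda>x. f x * g x) has_derivative
        (\<lambda>v. f x * frechet_derivative g (at x) v + frechet_derivative f (at x) v * g x)) (at x)"
        using Suc.prems that by (intro has_derivative_mult) (simp_all flip: frechet_derivative_works)
      from frechet_derivative_at[OF this] show ?thesis by (simp add: fun_eq_iff)
    qed
    moreover have "higher_differentiable_on S
      (\<lambda>x. f x * frechet_derivative g (at x) v + frechet_derivative f (at x) v * g x) n"
      using Suc.prems higher_differentiable_on_lower[OF Suc.prems(1)] higher_differentiable_on_lower[OF Suc.prems(2)]
      by (intro higher_differentiable_on_add assms(1) Suc.IH) simp_all
    ultimately show ?thesis
      using higher_differentiable_on_cong[OF assms(1)] by (metis (no_types, lifting))
  qed
  then show ?case using Suc.prems by simp
qed

lemma smooth_on_differentiable: "smooth_on S f \<Longrightarrow> x \<in> S \<Longrightarrow> f differentiable at x"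
  unfolding smooth_on_def by (metis higher_differentiable_on.simps(2))

lemma smooth_on_frechet_derivative:
  "smooth_on S f \<Longrightarrow> smooth_on S (\<lambda>x. frechet_derivative f (at x) v)"
  unfolding smooth_on_def by (metis higher_differentiable_on.simps(2))

lemma smooth_on_mult:
  fixes f g :: "'a::real_normed_vector \<Rightarrow> real"
  shows "open S \<Longrightarrow> smooth_on S f \<Longrightarrow> smooth_on S g \<Longrightarrow> smooth_on S (\<lambda>x. f x * g x)"
  unfolding smooth_on_def using higher_differentiable_on_mult[of S f _ g] by blast

lemma smooth_on_cong:
  "open S \<Longrightarrow> (\<And>x. x \<in> S \<Longrightarrow> f x = g x) \<Longrightarrow> smooth_on S f \<longleftrightarrow> smooth_on S g"
  unfolding smooth_on_def using higher_differentiable_on_cong[of S f g] by blast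

section \<open>Symmetry of second derivatives\<close>

lemma directional_mean_value:
  fixes f :: "'a::real_normed_vector \<Rightarrow> real"
  assumes "s > 0" and "\<And>t. 0 \<le> t \<Longrightarrow> t \<le> s \<Longrightarrow> f differentiable at (p + t *\<^sub>R v)"
  obtains t where "0 < t" "t < s"
    "f (p + s *\<^sub>R v) - f p = s * frechet_derivative f (at (p + t *\<^sub>R v)) v"
proof -
  have "((\<lambda>t. f (p + t *\<^sub>R v)) has_real_derivative frechet_derivative f (at (p + t *\<^sub>R v)) v) (at t)"
    if "0 \<le> t" "t \<le> s" for t
  proof -
    have "(f has_derivative frechet_derivative f (at (p + t *\<^sub>R v))) (at (p + t *\<^sub>R v))"
      using assms(2)[OF that] by (simp add: frechet_derivative_works)
    moreover have "((\<lambda>t. p + t *\<^sub>R v) has_derivative (\<lambda>t. t *\<^sub>R v)) (at t)"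
      by (auto intro!: derivative_eq_intros)
    ultimately have *: "((\<lambda>t. f (p + t *\<^sub>R v)) has_derivative
        (\<lambda>h. frechet_derivative f (at (p + t *\<^sub>R v)) (h *\<^sub>R v))) (at t)"
      using has_derivative_compose by blast
    have "linear (frechet_derivative f (at (p + t *\<^sub>R v)))"
      using assms(2)[OF that] by (rule linear_frechet_derivative)
    then have "(\<lambda>h. frechet_derivative f (at (p + t *\<^sub>R v)) (h *\<^sub>R v))
      = (*) (frechet_derivative f (at (p + t *\<^sub>R v)) v)"
      by (auto simp: linear_cmul mult.commute)
    with * show ?thesis by (simp add: has_field_derivative_def)
  qed
  then obtain t where "0 < t" "t < s"
    "f (p + s *\<^sub>R v) - f (p + 0 *\<^sub>R v) = (s - 0) * frechet_derivative f (at (p + t *\<^sub>R v)) v"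
    using MVT2[OF assms(1), of "\<lambda>t. f (p + t *\<^sub>R v)" "\<lambda>t. frechet_derivative f (at (p + t *\<^sub>R v)) v"]
    by blast
  then show ?thesis using that by simp
qed

text \<open>The increment of f by \<open>s *\<^sub>R v\<close> is itself a function of the base
  point. The mean value theorem is applied to it along u, and then along v to the derivative of f in
  direction u. The second difference is unchanged when u and v are swapped, which is what relates
  the two mixed derivatives.\<close>

lemma second_difference_mean_value:
  fixes f :: "'a::real_normed_vector \<Rightarrow> real"
  assumes "smooth_on S f" and "s > 0"
    and S: "\<And>a b. 0 \<le> a \<Longrightarrow> a \<le> s \<Longrightarrow> 0 \<le> b \<Longrightarrow> b \<le> s \<Longrightarrow> p + a *\<^sub>R u + b *\<^sub>R v \<in> S"
  obtains a b where "0 < a" "a < s" "0 < b" "b < s"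
    "f (p + s *\<^sub>R u + s *\<^sub>R v) - f (p + s *\<^sub>R u) - (f (p + s *\<^sub>R v) - f p)
      = s\<^sup>2 * frechet_derivative (\<lambda>x. frechet_derivative f (at x) u) (at (p + a *\<^sub>R u + b *\<^sub>R v)) v"
proof -
  let ?g = "\<lambda>x. f (x + s *\<^sub>R v) - f x"
  have d1: "f differentiable at (p + a *\<^sub>R u + s *\<^sub>R v)" "f differentiable at (p + a *\<^sub>R u)"
    if "0 \<le> a" "a \<le> s" for a
    using S[OF that, of s] S[OF that, of 0] assms(1,2) by (auto intro: smooth_on_differentiable)
  have hd: "(?g has_derivative (\<lambda>h. frechet_derivative f (at (p + a *\<^sub>R u + s *\<^sub>R v)) h
      - frechet_derivative f (at (p + a *\<^sub>R u)) h)) (at (p + a *\<^sub>R u))"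
    if "0 \<le> a" "a \<le> s" for a
  proof (rule has_derivative_diff)
    have "(f has_derivative frechet_derivative f (at (p + a *\<^sub>R u + s *\<^sub>R v))) (at (p + a *\<^sub>R u + s *\<^sub>R v))"
      using d1[OF that] by (simp add: frechet_derivative_works)
    moreover have "((\<lambda>x. x + s *\<^sub>R v) has_derivative (\<lambda>h. h)) (at (p + a *\<^sub>R u))"
      by (auto intro!: derivative_eq_intros)
    ultimately show "((\<lambda>x. f (x + s *\<^sub>R v)) has_derivative frechet_derivative f (at (p + a *\<^sub>R u + s *\<^sub>R v)))
        (at (p + a *\<^sub>R u))"
      using has_derivative_compose by blast
    show "(f has_derivative frechet_derivative f (at (p + a *\<^sub>R u))) (at (p + a *\<^sub>R u))"
      using d1[OF that] by (simp add: frechet_derivative_works)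
  qed
  then have gd: "?g differentiable at (p + a *\<^sub>R u)" if "0 \<le> a" "a \<le> s" for a
    using that unfolding differentiable_def by blast
  obtain a where a: "0 < a" "a < s"
    "?g (p + s *\<^sub>R u) - ?g p = s * frechet_derivative ?g (at (p + a *\<^sub>R u)) u"
    using directional_mean_value[of s ?g p u, OF assms(2) gd] by blast
  have fg: "frechet_derivative ?g (at (p + a *\<^sub>R u)) u
     = frechet_derivative f (at (p + a *\<^sub>R u + s *\<^sub>R v)) u - frechet_derivative f (at (p + a *\<^sub>R u)) u"
    using frechet_derivative_at[OF hd[of a], symmetric] a by simp
  have "(\<lambda>x. frechet_derivative f (at x) u) differentiable at (p + a *\<^sub>R u + t *\<^sub>R v)"
    if "0 \<le> t" "t \<le> s" for t
    using S[of a t] a that assms(1) by (auto intro: smooth_on_differentiable smooth_on_frechet_derivative)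
  then obtain b where b: "0 < b" "b < s"
    "frechet_derivative f (at (p + a *\<^sub>R u + s *\<^sub>R v)) u - frechet_derivative f (at (p + a *\<^sub>R u)) u
     = s * frechet_derivative (\<lambda>x. frechet_derivative f (at x) u) (at (p + a *\<^sub>R u + b *\<^sub>R v)) v"
    using directional_mean_value[of s "\<lambda>x. frechet_derivative f (at x) u" "p + a *\<^sub>R u" v, OF assms(2)]
    by blast
  show ?thesis
    using that[OF a(1,2) b(1,2)] a(3) b(3) fg by (simp add: power2_eq_square)
qed

text \<open>Divided by s^2, the symmetric second difference tends to either mixed derivative as s
  decreases to 0, because both are continuous at p; limits are unique.\<close>

lemma second_derivative_symmetric:
  fixes f :: "'a::real_normed_vector \<Rightarrow> real"
  assumes "smooth_on S f" "open S" "p \<in> S"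
  shows "frechet_derivative (\<lambda>x. frechet_derivative f (at x) u) (at p) v
       = frechet_derivative (\<lambda>x. frechet_derivative f (at x) v) (at p) u"
proof -
  let ?D = "\<lambda>u v x. frechet_derivative (\<lambda>x. frechet_derivative f (at x) u) (at x) v"
  let ?\<Delta> = "\<lambda>s. f (p + s *\<^sub>R u + s *\<^sub>R v) - f (p + s *\<^sub>R u) - (f (p + s *\<^sub>R v) - f p)"
  have lim: "((\<lambda>s. (f (p + s *\<^sub>R u + s *\<^sub>R v) - f (p + s *\<^sub>R u) - (f (p + s *\<^sub>R v) - f p)) / s\<^sup>2)
      \<longlongrightarrow> ?D u v p) (at_right 0)" for u v
  proof (rule tendstoI)
    fix e :: real assume "e > 0"
    have "isCont (?D u v) p"
      using assms smooth_on_frechet_derivative smooth_on_differentiable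
      by (metis differentiable_imp_continuous_within)
    then obtain d1 where d1: "d1 > 0" "\<And>x. dist x p < d1 \<Longrightarrow> dist (?D u v x) (?D u v p) < e"
      using \<open>e > 0\<close> unfolding continuous_at_eps_delta by blast
    obtain d2 where d2: "d2 > 0" "\<And>x. dist x p < d2 \<Longrightarrow> x \<in> S"
      using assms(2,3) unfolding open_dist by blast
    \<comment> \<open>For s < d the offset has norm below d (norm u + norm v + 1), hence below both
      radii; the summand 1 keeps the denominator positive when u = v = 0.\<close>
    define d where "d = min d1 d2 / (norm u + norm v + 1)"
    have "norm u + norm v + 1 > 0" using norm_ge_zero[of u] norm_ge_zero[of v] by linarith
    then have "d > 0" using d1 d2 by (simp add: d_def)
    have close: "dist (p + a *\<^sub>R u + b *\<^sub>R v) p < min d1 d2"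
      if "0 \<le> a" "a \<le> s" "0 \<le> b" "b \<le> s" "s < d" for a b s
    proof -
      have "dist (p + a *\<^sub>R u + b *\<^sub>R v) p = norm (a *\<^sub>R u + b *\<^sub>R v)"
        by (simp add: dist_norm)
      also have "\<dots> \<le> a * norm u + b * norm v"
        using norm_triangle_ineq[of "a *\<^sub>R u" "b *\<^sub>R v"] that by simp
      also have "\<dots> \<le> s * norm u + s * norm v"
        using that by (intro add_mono mult_right_mono) auto
      also have "\<dots> \<le> s * (norm u + norm v + 1)"
        using that by (simp add: algebra_simps)
      also have "\<dots> < d * (norm u + norm v + 1)"
        using that \<open>norm u + norm v + 1 > 0\<close> by (intro mult_strict_right_mono) auto
      also have "\<dots> = min d1 d2"
        using \<open>norm u + norm v + 1 > 0\<close> by (simp add: d_def)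
      finally show ?thesis .
    qed
    have "dist ((f (p + s *\<^sub>R u + s *\<^sub>R v) - f (p + s *\<^sub>R u) - (f (p + s *\<^sub>R v) - f p)) / s\<^sup>2) (?D u v p) < e"
      if s: "0 < s" "s < d" for s
    proof -
      obtain a b where ab: "0 < a" "a < s" "0 < b" "b < s"
        "f (p + s *\<^sub>R u + s *\<^sub>R v) - f (p + s *\<^sub>R u) - (f (p + s *\<^sub>R v) - f p)
          = s\<^sup>2 * ?D u v (p + a *\<^sub>R u + b *\<^sub>R v)"
      proof (rule second_difference_mean_value[OF assms(1) s(1), of p u v])
        show "p + a *\<^sub>R u + b *\<^sub>R v \<in> S" if "0 \<le> a" "a \<le> s" "0 \<le> b" "b \<le> s" for a b
          using close[OF that s(2)] d2 by simp
      qed blast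
      show ?thesis
        using close[of a s b] ab s d1 by simp
    qed
    then show "\<forall>\<^sub>F s in at_right 0.
        dist ((f (p + s *\<^sub>R u + s *\<^sub>R v) - f (p + s *\<^sub>R u) - (f (p + s *\<^sub>R v) - f p)) / s\<^sup>2) (?D u v p) < e"
      using \<open>d > 0\<close> by (auto simp: eventually_at_right_field)
  qed
  have "(\<lambda>s. ?\<Delta> s / s\<^sup>2) =
      (\<lambda>s. (f (p + s *\<^sub>R v + s *\<^sub>R u) - f (p + s *\<^sub>R v) - (f (p + s *\<^sub>R u) - f p)) / s\<^sup>2)"
    by (simp add: add.commute add.left_commute fun_eq_iff)
  then show ?thesis
    using tendsto_unique[OF trivial_limit_at_right_real lim[of u v]] lim[of v u] by simp
qed

section \<open>Partial derivatives of local fields\<close>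

lemma pd_has_derivative: "(f has_derivative f') (at x) \<Longrightarrow> pd i f x = f' (axis i 1)"
  unfolding pd_def using frechet_derivative_at by metis

lemma pd_const: "pd i (\<lambda>x. c) x = 0"
  by (simp add: pd_has_derivative[OF has_derivative_const])

lemma pd_mult:
  assumes "f differentiable at x" "g differentiable at x"
  shows "pd i (\<lambda>x. f x * g x) x = f x * pd i g x + pd i f x * g x"
  using assms unfolding pd_def[of i f] pd_def[of i g] frechet_derivative_works
  by (intro pd_has_derivative[OF has_derivative_mult])

lemma pd_add:
  assumes "f differentiable at x" "g differentiable at x"
  shows "pd i (\<lambda>x. f x + g x) x = pd i f x + pd i g x"
  using assms unfolding pd_def[of i f] pd_def[of i g] frechet_derivative_works
  by (intro pd_has_derivative[OF has_derivative_add])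

lemma pd_sum:
  assumes "\<And>r. r \<in> I \<Longrightarrow> f r differentiable at x"
  shows "pd i (\<lambda>x. \<Sum>r\<in>I. f r x) x = (\<Sum>r\<in>I. pd i (f r) x)"
  using assms unfolding pd_def[of i "f _"] frechet_derivative_works
  by (intro pd_has_derivative[OF has_derivative_sum])

lemma pd_component: "pd i (\<lambda>x. x $ j) x = (if i = j then 1 else 0)"
  by (subst pd_has_derivative[where f' = "\<lambda>h. h $ j"])
    (auto simp: axis_def intro!: bounded_linear_imp_has_derivative bounded_linear_vec_nth)

lemma pd_exp:
  assumes "f differentiable at x"
  shows "pd i (\<lambda>x. exp (f x)) x = exp (f x) * pd i f x"
  using assms unfolding pd_def[of i f] frechet_derivative_works
  by (subst pd_has_derivative[OF has_derivative_exp]) auto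

lemma pd_cong:
  assumes "open S" "x \<in> S" "\<And>x. x \<in> S \<Longrightarrow> f x = g x"
  shows "pd i f x = pd i g x"
proof -
  have "(f has_derivative f') (at x) \<longleftrightarrow> (g has_derivative f') (at x)" for f'
    using has_derivative_transform_within_open[OF _ assms(1,2), of f f' UNIV g]
      has_derivative_transform_within_open[OF _ assms(1,2), of g f' UNIV f] assms(3) by auto
  then show ?thesis by (simp add: pd_def frechet_derivative_def)
qed

section \<open>Fields on the tangent bundle without its zero section\<close>

text \<open>Differentiability in x and in y separately: \<open>dx\<close> and \<open>dy\<close>
  freeze the other variable, so their sum and product rules ask for no more.\<close>

definition field_diff :: "'n::finite field \<Rightarrow> real^'n \<Rightarrow> real^'n \<Rightarrow> bool" where
  "field_diff f x y \<longleftrightarrow> (\<lambda>x'. f x' y) differentiable at x \<and> f x differentiable at y"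

text \<open>Joint smoothness, as needed to interchange derivatives. The point y = 0 is excluded
  because a positive function homogeneous of degree one is in general not smooth there.\<close>

definition smooth_field :: "(real^'n) set \<Rightarrow> 'n::finite field \<Rightarrow> bool" where
  "smooth_field X f \<longleftrightarrow> smooth_on (X \<times> (UNIV - {0})) (\<lambda>(x, y). f x y)"

lemma field_diff_const: "field_diff (\<lambda>x y. c) x y"
  by (simp add: field_diff_def)

lemma field_diff_component: "field_diff (\<lambda>x y. y $ i) x y"
  by (simp add: field_diff_def bounded_linear_imp_differentiable bounded_linear_vec_nth)

lemma field_diff_base: "f differentiable at x \<Longrightarrow> field_diff (\<lambda>x y. f x) x y"
  by (simp add: field_diff_def)

lemma field_diff_mult:
  "field_diff f x y \<Longrightarrow> field_diff g x y \<Longrightarrow> field_diff (\<lambda>x y. f x y * g x y) x y"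
  by (simp add: field_diff_def)

lemma field_diff_add:
  "field_diff f x y \<Longrightarrow> field_diff g x y \<Longrightarrow> field_diff (\<lambda>x y. f x y + g x y) x y"
  by (simp add: field_diff_def)

lemma field_diff_sum:
  "(\<And>r. r \<in> I \<Longrightarrow> field_diff (f r) x y) \<Longrightarrow> finite I \<Longrightarrow> field_diff (\<lambda>x y. \<Sum>r\<in>I. f r x y) x y"
  by (simp add: field_diff_def)

lemma dx_const: "dx i (\<lambda>x y. c) x y = 0"
  and dy_const: "dy i (\<lambda>x y. c) x y = 0"
  by (simp_all add: dx_def dy_def pd_const)

lemma dx_mult:
  "field_diff f x y \<Longrightarrow> field_diff g x y \<Longrightarrow>
    dx i (\<lambda>x y. f x y * g x y) x y = f x y * dx i g x y + dx i f x y * g x y"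
  and dy_mult:
  "field_diff f x y \<Longrightarrow> field_diff g x y \<Longrightarrow>
    dy i (\<lambda>x y. f x y * g x y) x y = f x y * dy i g x y + dy i f x y * g x y"
  by (simp_all add: dx_def dy_def field_diff_def pd_mult)

lemma dx_add:
  "field_diff f x y \<Longrightarrow> field_diff g x y \<Longrightarrow>
    dx i (\<lambda>x y. f x y + g x y) x y = dx i f x y + dx i g x y"
  and dy_add:
  "field_diff f x y \<Longrightarrow> field_diff g x y \<Longrightarrow>
    dy i (\<lambda>x y. f x y + g x y) x y = dy i f x y + dy i g x y"
  by (simp_all add: dx_def dy_def field_diff_def pd_add)

lemma dx_sum:
  "(\<And>r. r \<in> I \<Longrightarrow> field_diff (f r) x y) \<Longrightarrow>
    dx i (\<lambda>x y. \<Sum>r\<in>I. f r x y) x y = (\<Sum>r\<in>I. dx i (f r) x y)"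
  and dy_sum:
  "(\<And>r. r \<in> I \<Longrightarrow> field_diff (f r) x y) \<Longrightarrow>
    dy i (\<lambda>x y. \<Sum>r\<in>I. f r x y) x y = (\<Sum>r\<in>I. dy i (f r) x y)"
  by (simp_all add: dx_def dy_def field_diff_def pd_sum)

lemma dx_component: "dx i (\<lambda>x y. y $ j) x y = 0"
  and dy_component: "dy i (\<lambda>x y. y $ j) x y = (if i = j then 1 else 0)"
  by (simp_all add: dx_def dy_def pd_const pd_component)

lemma dx_base: "dx i (\<lambda>x y. f x) x y = pd i f x"
  and dy_base: "dy i (\<lambda>x y. f x) x y = 0"
  by (simp_all add: dx_def dy_def pd_const)

lemma dx_cong:
  assumes "open X" "x \<in> X" "\<And>x. x \<in> X \<Longrightarrow> f x y = g x y"
  shows "dx i f x y = dx i g x y"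
  unfolding dx_def by (rule pd_cong[of X]) (use assms in auto)

lemma dy_cong:
  assumes "y \<noteq> 0" "\<And>y. y \<noteq> 0 \<Longrightarrow> f x y = g x y"
  shows "dy i f x y = dy i g x y"
  unfolding dy_def by (rule pd_cong[of "UNIV - {0}"]) (use assms in auto)

lemma smooth_field_differentiable:
  "smooth_field X f \<Longrightarrow> x \<in> X \<Longrightarrow> y \<noteq> 0 \<Longrightarrow> case_prod f differentiable at (x, y)"
  unfolding smooth_field_def by (rule smooth_on_differentiable) auto

lemma section_has_derivative:
  assumes "case_prod f differentiable at (x, y)"
  shows "((\<lambda>x'. f x' y) has_derivative (\<lambda>h. frechet_derivative (case_prod f) (at (x, y)) (h, 0))) (at x)"
    and "(f x has_derivative (\<lambda>h. frechet_derivative (case_prod f) (at (x, y)) (0, h))) (at y)"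
proof -
  have D: "(case_prod f has_derivative frechet_derivative (case_prod f) (at (x, y))) (at (x, y))"
    using assms by (simp flip: frechet_derivative_works)
  have "((\<lambda>x'. (x', y)) has_derivative (\<lambda>h. (h, 0))) (at x)"
    by (intro has_derivative_Pair has_derivative_ident has_derivative_const)
  from has_derivative_compose[OF this D]
  show "((\<lambda>x'. f x' y) has_derivative (\<lambda>h. frechet_derivative (case_prod f) (at (x, y)) (h, 0))) (at x)"
    by simp
  have "((\<lambda>y'. (x, y')) has_derivative (\<lambda>h. (0, h))) (at y)"
    by (intro has_derivative_Pair has_derivative_ident has_derivative_const)
  from has_derivative_compose[OF this D]
  show "(f x has_derivative (\<lambda>h. frechet_derivative (case_prod f) (at (x, y)) (0, h))) (at y)"
    by simp
qed

lemma smooth_field_diff: "smooth_field X f \<Longrightarrow> x \<in> X \<Longrightarrow> y \<noteq> 0 \<Longrightarrow> field_diff f x y"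
  unfolding field_diff_def
  using differentiableI[OF section_has_derivative(1)[of f x y]] differentiableI[OF section_has_derivative(2)[of f x y]]
    smooth_field_differentiable[of X f x y] by simp

text \<open>On smooth fields both partial derivatives are directional derivatives of one uncurried
  function, so the symmetry of its second derivative yields the commutation rules for
  \<open>dx\<close> and \<open>dy\<close>.\<close>

lemma dx_eq_frechet:
  "smooth_field X f \<Longrightarrow> x \<in> X \<Longrightarrow> y \<noteq> 0 \<Longrightarrow>
    dx i f x y = frechet_derivative (case_prod f) (at (x, y)) (axis i 1, 0)"
  and dy_eq_frechet:
  "smooth_field X f \<Longrightarrow> x \<in> X \<Longrightarrow> y \<noteq> 0 \<Longrightarrow>
    dy i f x y = frechet_derivative (case_prod f) (at (x, y)) (0, axis i 1)"
  using section_has_derivative[OF smooth_field_differentiable] pd_has_derivative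
  unfolding dx_def dy_def by fast+

lemma open_slit: "open X \<Longrightarrow> open (X \<times> (UNIV - {0::'a::{t1_space,zero}}))"
  by (intro open_Times open_delete open_UNIV)

lemma smooth_field_frechet:
  "smooth_field X f \<Longrightarrow> smooth_field X (\<lambda>x y. frechet_derivative (case_prod f) (at (x, y)) v)"
  unfolding smooth_field_def
  using smooth_on_frechet_derivative[of _ "case_prod f" v] by (simp add: case_prod_unfold)

lemma smooth_field_cong:
  assumes "open X" "\<And>x y. x \<in> X \<Longrightarrow> y \<noteq> 0 \<Longrightarrow> f x y = g x y"
  shows "smooth_field X f \<longleftrightarrow> smooth_field X g"
  unfolding smooth_field_def using assms by (intro smooth_on_cong open_slit) auto

lemma smooth_field_dx: "open X \<Longrightarrow> smooth_field X f \<Longrightarrow> smooth_field X (dx i f)"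
  by (rule iffD2[OF smooth_field_cong smooth_field_frechet[of X f "(axis i 1, 0)"]])
    (auto simp: dx_eq_frechet)

lemma smooth_field_dy: "open X \<Longrightarrow> smooth_field X f \<Longrightarrow> smooth_field X (dy i f)"
  by (rule iffD2[OF smooth_field_cong smooth_field_frechet[of X f "(0, axis i 1)"]])
    (auto simp: dy_eq_frechet)

lemma smooth_field_mult:
  "open X \<Longrightarrow> smooth_field X f \<Longrightarrow> smooth_field X g \<Longrightarrow> smooth_field X (\<lambda>x y. f x y * g x y)"
  unfolding smooth_field_def
  using smooth_on_mult[OF open_slit, of X "case_prod f" "case_prod g"] by (simp add: case_prod_unfold)

lemma smooth_field_const: "smooth_field X (\<lambda>x y. c)"
  by (simp add: smooth_field_def smooth_on_def case_prod_unfold higher_differentiable_on_const)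

lemma frechet_commute:
  assumes "open X" "smooth_field X f" "x \<in> X" "y \<noteq> 0"
  shows "frechet_derivative (\<lambda>(x, y). frechet_derivative (case_prod f) (at (x, y)) u) (at (x, y)) v
       = frechet_derivative (\<lambda>(x, y). frechet_derivative (case_prod f) (at (x, y)) v) (at (x, y)) u"
  using second_derivative_symmetric[of "X \<times> (UNIV - {0})" "case_prod f" "(x, y)" u v] assms
  by (simp add: open_slit smooth_field_def case_prod_unfold)

lemma dy_dx_commute:
  assumes "open X" "smooth_field X f" "x \<in> X" "y \<noteq> 0"
  shows "dy i (dx j f) x y = dx j (dy i f) x y"
proof -
  let ?F = "\<lambda>v x y. frechet_derivative (case_prod f) (at (x, y)) v"
  have "dy i (dx j f) x y = dy i (?F (axis j 1, 0)) x y"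
    using assms by (intro dy_cong dx_eq_frechet)
  also have "\<dots> = dx j (?F (0, axis i 1)) x y"
    using assms dx_eq_frechet[OF smooth_field_frechet] dy_eq_frechet[OF smooth_field_frechet]
      frechet_commute by metis
  also have "\<dots> = dx j (dy i f) x y"
    using assms by (intro dx_cong[of X] dy_eq_frechet[symmetric])
  finally show ?thesis .
qed

lemma dy_dy_commute:
  assumes "open X" "smooth_field X f" "x \<in> X" "y \<noteq> 0"
  shows "dy i (dy j f) x y = dy j (dy i f) x y"
proof -
  let ?F = "\<lambda>v x y. frechet_derivative (case_prod f) (at (x, y)) v"
  have "dy i (dy j f) x y = dy i (?F (0, axis j 1)) x y"
    using assms by (intro dy_cong dy_eq_frechet)
  also have "\<dots> = dy j (?F (0, axis i 1)) x y"
    using assms dy_eq_frechet[OF smooth_field_frechet] frechet_commute by metis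
  also have "\<dots> = dy j (dy i f) x y"
    using assms by (intro dy_cong dy_eq_frechet[symmetric])
  finally show ?thesis .
qed

section \<open>Euler's theorem\<close>

text \<open>Homogeneity of degree d in y in infinitesimal form. Being an equation between
  derivatives, it can be differentiated again, which gives the degrees of \<open>dy i f\<close> and
  \<open>dx i f\<close> without a scaling argument.\<close>

definition euler :: "(real^'n) set \<Rightarrow> real \<Rightarrow> 'n::finite field \<Rightarrow> bool" where
  "euler X d f \<longleftrightarrow> (\<forall>x\<in>X. \<forall>y. y \<noteq> 0 \<longrightarrow> (\<Sum>j\<in>UNIV. y $ j * dy j f x y) = d * f x y)"

lemma eulerD: "euler X d f \<Longrightarrow> x \<in> X \<Longrightarrow> y \<noteq> 0 \<Longrightarrow> (\<Sum>j\<in>UNIV. y $ j * dy j f x y) = d * f x y"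
  by (simp add: euler_def)

lemma linear_pd:
  assumes "f differentiable at x"
  shows "frechet_derivative f (at x) v = (\<Sum>j\<in>UNIV. v $ j * pd j f x)"
proof -
  have lin: "linear (frechet_derivative f (at x))" using assms by (rule linear_frechet_derivative)
  have "frechet_derivative f (at x) v = frechet_derivative f (at x) (\<Sum>j\<in>UNIV. v $ j *\<^sub>R axis j 1)"
    using basis_expansion[of v] by (simp add: scalar_mult_eq_scaleR)
  then show ?thesis
    by (simp add: linear_sum[OF lin] linear_cmul[OF lin] pd_def)
qed

lemma euler_homogeneous:
  assumes "smooth_field X f"
    and "\<And>x y t. x \<in> X \<Longrightarrow> t > 0 \<Longrightarrow> f x (t *\<^sub>R y) = t * f x y"
  shows "euler X 1 f"
  unfolding euler_def
proof (intro ballI allI impI)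
  fix x y assume xy: "x \<in> X" "y \<noteq> (0 :: real^'a)"
  have d: "f x differentiable at y"
    using smooth_field_diff[OF assms(1) xy] by (simp add: field_diff_def)
  have "(f x has_derivative frechet_derivative (f x) (at y)) (at (1 *\<^sub>R y))"
    using d by (simp flip: frechet_derivative_works)
  moreover have "((\<lambda>t. t *\<^sub>R y) has_derivative (\<lambda>h. h *\<^sub>R y)) (at 1)"
    by (auto intro!: derivative_eq_intros)
  ultimately have 1: "((\<lambda>t. f x (t *\<^sub>R y)) has_derivative
      (\<lambda>h. frechet_derivative (f x) (at y) (h *\<^sub>R y))) (at 1)"
    using has_derivative_compose[of "\<lambda>t. t *\<^sub>R y" _ 1 UNIV "f x"] by blast
  have "((\<lambda>t. t * f x y) has_derivative (\<lambda>h. h * f x y)) (at 1)"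
    by (auto intro!: derivative_eq_intros)
  \<comment> \<open>Homogeneity is given for t > 0 only, hence the open half-line around 1.\<close>
  from has_derivative_transform_within_open[OF this, of "{0<..}" "\<lambda>t. f x (t *\<^sub>R y)"]
  have "((\<lambda>t. f x (t *\<^sub>R y)) has_derivative (\<lambda>h. h * f x y)) (at 1)"
    using assms(2) xy by auto
  with 1 have "frechet_derivative (f x) (at y) (1 *\<^sub>R y) = 1 * f x y"
    using has_derivative_unique by metis
  then show "(\<Sum>j\<in>UNIV. y $ j * dy j f x y) = 1 * f x y"
    using linear_pd[OF d, of y] by (simp add: dy_def)
qed

text \<open>Differentiating Euler's relation also hits the coordinate factors; this extra term is
  \<open>dy i f\<close>, and it lowers the degree by one.\<close>

lemma euler_dy:
  assumes "open X" "smooth_field X f" "euler X d f"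
  shows "euler X (d - 1) (dy i f)"
  unfolding euler_def
proof (intro ballI allI impI)
  fix x y assume xy: "x \<in> X" "y \<noteq> (0 :: real^'a)"
  note sm = smooth_field_diff[OF smooth_field_dy[OF assms(1,2)] xy]
  have "dy i (\<lambda>x y. \<Sum>j\<in>UNIV. y $ j * dy j f x y) x y = dy i (\<lambda>x y. d * f x y) x y"
    using assms(3) xy by (intro dy_cong) (auto simp: euler_def)
  moreover have "dy i (\<lambda>x y. \<Sum>j\<in>UNIV. y $ j * dy j f x y) x y
      = (\<Sum>j\<in>UNIV. y $ j * dy i (dy j f) x y + (if i = j then 1 else 0) * dy j f x y)"
    by (simp add: dy_sum dy_mult dy_component field_diff_mult field_diff_component sm)
  moreover have "dy i (\<lambda>x y. d * f x y) x y = d * dy i f x y"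
    by (simp add: dy_mult dy_const field_diff_const smooth_field_diff[OF assms(2) xy])
  moreover have "(\<Sum>j\<in>UNIV. (if i = j then 1 else 0) * dy j f x y) = dy i f x y"
    by (simp add: if_distrib[of "\<lambda>t. t * _"] cong: if_cong)
  ultimately show "(\<Sum>j\<in>UNIV. y $ j * dy j (dy i f) x y) = (d - 1) * dy i f x y"
    using dy_dy_commute[OF assms(1,2) xy, of i] by (simp add: sum.distrib left_diff_distrib)
qed

lemma euler_dx:
  assumes "open X" "smooth_field X f" "euler X d f"
  shows "euler X d (dx i f)"
  unfolding euler_def
proof (intro ballI allI impI)
  fix x y assume xy: "x \<in> X" "y \<noteq> (0 :: real^'a)"
  note sm = smooth_field_diff[OF smooth_field_dy[OF assms(1,2)] xy]
  have "dx i (\<lambda>x y. \<Sum>j\<in>UNIV. y $ j * dy j f x y) x y = dx i (\<lambda>x y. d * f x y) x y"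
    using assms(1,3) xy by (intro dx_cong[of X]) (auto simp: euler_def)
  moreover have "dx i (\<lambda>x y. \<Sum>j\<in>UNIV. y $ j * dy j f x y) x y = (\<Sum>j\<in>UNIV. y $ j * dx i (dy j f) x y)"
    by (simp add: dx_sum dx_mult dx_component field_diff_mult field_diff_component sm)
  moreover have "dx i (\<lambda>x y. d * f x y) x y = d * dx i f x y"
    by (simp add: dx_mult dx_const field_diff_const smooth_field_diff[OF assms(2) xy])
  ultimately show "(\<Sum>j\<in>UNIV. y $ j * dy j (dx i f) x y) = d * dx i f x y"
    using dy_dx_commute[OF assms(1,2) xy] by simp
qed

lemma euler_square:
  assumes "open X" "smooth_field X f" "euler X d f"
  shows "euler X (2 * d) (\<lambda>x y. (f x y)\<^sup>2)"
  unfolding euler_def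
proof (intro ballI allI impI)
  fix x y assume xy: "x \<in> X" "y \<noteq> (0 :: real^'a)"
  have "dy j (\<lambda>x y. (f x y)\<^sup>2) x y = 2 * f x y * dy j f x y" for j
    using smooth_field_diff[OF assms(2) xy] by (simp add: power2_eq_square dy_mult)
  then have "(\<Sum>j\<in>UNIV. y $ j * dy j (\<lambda>x y. (f x y)\<^sup>2) x y)
      = 2 * f x y * (\<Sum>j\<in>UNIV. y $ j * dy j f x y)"
    by (simp add: sum_distrib_left mult.left_commute)
  then show "(\<Sum>j\<in>UNIV. y $ j * dy j (\<lambda>x y. (f x y)\<^sup>2) x y) = 2 * d * (f x y)\<^sup>2"
    using assms(3) xy by (simp add: euler_def power2_eq_square)
qed

section \<open>The horizontal derivative\<close>

lemma delta_mult:
  assumes "field_diff f x y" "field_diff g x y"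
  shows "delta L k (\<lambda>x y. f x y * g x y) x y = f x y * delta L k g x y + delta L k f x y * g x y"
  unfolding delta_def dx_mult[OF assms] dy_mult[OF assms]
  by (simp add: algebra_simps sum.distrib sum_distrib_left)

lemma delta_add:
  assumes "field_diff f x y" "field_diff g x y"
  shows "delta L k (\<lambda>x y. f x y + g x y) x y = delta L k f x y + delta L k g x y"
  unfolding delta_def dx_add[OF assms] dy_add[OF assms]
  by (simp add: algebra_simps sum.distrib)

lemma delta_sum:
  assumes "\<And>r. r \<in> I \<Longrightarrow> field_diff (f r) x y"
  shows "delta L k (\<lambda>x y. \<Sum>r\<in>I. f r x y) x y = (\<Sum>r\<in>I. delta L k (f r) x y)"
proof -
  have "dx k (\<lambda>x y. \<Sum>r\<in>I. f r x y) x y = (\<Sum>r\<in>I. dx k (f r) x y)"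
    using assms by (rule dx_sum)
  moreover have "dy j (\<lambda>x y. \<Sum>r\<in>I. f r x y) x y = (\<Sum>r\<in>I. dy j (f r) x y)" for j
    using assms by (rule dy_sum)
  ultimately show ?thesis
    by (simp add: delta_def sum_subtractf sum_distrib_left) (rule sum.swap)
qed

lemma delta_base: "delta L k (\<lambda>x y. f x) x y = pd k f x"
  by (simp add: delta_def dx_base dy_base)

lemma delta_component: "delta L k (\<lambda>x y. y $ j) x y = - nonlin L j k x y"
  by (simp add: delta_def dx_component dy_component if_distrib cong: if_cong)

text \<open>Identities such as g_ij y^j = L L_i hold only for x in X and y \<noteq> 0. Both
  conditions are open, so the identities may be differentiated horizontally.\<close>

lemma delta_cong:
  assumes "open X" "x \<in> X" "y \<noteq> 0" "\<And>x y. x \<in> X \<Longrightarrow> y \<noteq> 0 \<Longrightarrow> f x y = g x y"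
  shows "delta L k f x y = delta L k g x y"
  unfolding delta_def
  using dx_cong[of X x f y g] dy_cong[of y f x g] assms by simp

section \<open>Inverting the fundamental tensor\<close>

lemma posdef_invertible:
  fixes G :: "real^'n^'n"
  assumes "\<And>v. v \<noteq> 0 \<Longrightarrow> (\<Sum>i\<in>UNIV. \<Sum>j\<in>UNIV. G $ i $ j * v $ i * v $ j) > 0"
  shows "invertible G"
proof -
  have "v = 0" if "G *v v = 0" for v
  proof (rule ccontr)
    assume "v \<noteq> 0"
    have "(\<Sum>i\<in>UNIV. \<Sum>j\<in>UNIV. G $ i $ j * v $ i * v $ j) = (\<Sum>i\<in>UNIV. v $ i * (G *v v) $ i)"
      by (simp add: matrix_vector_mult_def sum_distrib_left mult_ac)
    then show False using assms[OF \<open>v \<noteq> 0\<close>] that by simp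
  qed
  then show ?thesis
    using matrix_left_invertible_ker matrix_left_right_inverse unfolding invertible_def by metis
qed

lemma matrix_inv_inverse:
  fixes G :: "real^'n^'n"
  assumes "invertible G"
  shows "G ** matrix_inv G = mat 1" "matrix_inv G ** G = mat 1"
  using someI_ex[OF assms[unfolded invertible_def]] unfolding matrix_inv_def by auto

lemma matrix_inv_sym:
  fixes G :: "real^'n^'n"
  assumes "invertible G" "transpose G = G"
  shows "transpose (matrix_inv G) = matrix_inv G"
proof -
  note inv = matrix_inv_inverse[OF assms(1)]
  have "transpose (matrix_inv G) ** G = mat 1"
    using matrix_transpose_mul[of G "matrix_inv G"] by (simp add: inv assms(2) transpose_mat)
  then have "(transpose (matrix_inv G) ** G) ** matrix_inv G = matrix_inv G"
    by simp
  then show ?thesis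
    unfolding matrix_mul_assoc[symmetric] inv by simp
qed

lemma matrix_inv_mult_vector:
  fixes G :: "real^'n^'n"
  assumes "invertible G" "\<And>i. (\<Sum>r\<in>UNIV. G $ i $ r * v r) = a i"
  shows "(\<Sum>r\<in>UNIV. matrix_inv G $ i $ r * a r) = v i"
proof -
  have "G *v (\<chi> r. v r) = (\<chi> i. a i)"
    using assms(2) by (simp add: matrix_vector_mult_def vec_eq_iff)
  then have "matrix_inv G *v (\<chi> i. a i) = (\<chi> r. v r)"
    using matrix_inv_inverse(2)[OF assms(1)] by (metis matrix_vector_mul_assoc matrix_vector_mul_lid)
  then show ?thesis by (simp add: matrix_vector_mult_def vec_eq_iff)
qed

lemma mult_matrix_inv_vector:
  fixes G :: "real^'n^'n"
  assumes "invertible G"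
  shows "(\<Sum>r\<in>UNIV. G $ i $ r * (\<Sum>j\<in>UNIV. matrix_inv G $ r $ j * a j)) = a i"
proof -
  have "(G *v (matrix_inv G *v (\<chi> j. a j))) $ i = a i"
    using matrix_inv_inverse(1)[OF assms] by (simp add: matrix_vector_mul_assoc)
  then show ?thesis by (simp add: matrix_vector_mult_def)
qed

text \<open>A determinant is a polynomial in the entries. This prepares the use of Cramer's rule for
  the spray, which avoids differentiating a matrix inverse.\<close>

lemma differentiable_det:
  fixes M :: "'a::real_normed_vector \<Rightarrow> real^'n^'n"
  assumes "\<And>i j. (\<lambda>y. M y $ i $ j) differentiable at y"
  shows "(\<lambda>y. det (M y)) differentiable at y"
proof -
  have "(\<lambda>y. \<Prod>i\<in>UNIV. M y $ i $ p i) differentiable at y" for p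
    by (rule differentiableI, rule has_derivative_prod, rule iffD1[OF frechet_derivative_works assms])
  then show ?thesis
    unfolding det_def by (intro differentiable_sum ballI differentiable_mult differentiable_const) simp_all
qed

section \<open>The Cartan connection of a Finsler metric in a chart\<close>

locale finsler_chart =
  fixes X :: "(real^'n::finite) set" and L :: "'n field"
  assumes open_X: "open X"
    and smooth_L: "smooth_field X L"
    and homogeneous: "\<And>x y t. x \<in> X \<Longrightarrow> t > 0 \<Longrightarrow> L x (t *\<^sub>R y) = t * L x y"
    and pos: "\<And>x y. x \<in> X \<Longrightarrow> y \<noteq> 0 \<Longrightarrow> L x y > 0"
    and posdef: "\<And>x y v. x \<in> X \<Longrightarrow> y \<noteq> 0 \<Longrightarrow> v \<noteq> 0 \<Longrightarrow>
      (\<Sum>i\<in>UNIV. \<Sum>j\<in>UNIV. fund L i j x y * v $ i * v $ j) > 0"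
begin

abbreviation Q :: "'n field" where "Q \<equiv> \<lambda>x y. (L x y)\<^sup>2"

section \<open>Homogeneity and symmetry of L, its derivatives and g\<close>

lemma smooth_Q: "smooth_field X Q"
  using smooth_field_mult[OF open_X smooth_L smooth_L] by (simp add: power2_eq_square)

lemma smooth_fund: "smooth_field X (fund L i j)"
  unfolding fund_def[abs_def]
  by (intro smooth_field_mult smooth_field_const smooth_field_dy open_X smooth_Q)

lemma smooth_L123: "smooth_field X (L1 L i)" "smooth_field X (L2 L i j)" "smooth_field X (L3 L i j k)"
  unfolding L1_def L2_def L3_def by (intro smooth_field_dy open_X smooth_L)+

lemma smooth_dy_Q: "smooth_field X (dy i Q)"
  by (intro smooth_field_dy open_X smooth_Q)

lemma euler_L: "euler X 1 L"
  using euler_homogeneous[OF smooth_L] homogeneous by blast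

lemma euler_Q: "euler X 2 Q"
  using euler_square[OF open_X smooth_L euler_L] by simp

lemma euler_dy_Q: "euler X 1 (dy i Q)"
  using euler_dy[OF open_X smooth_Q euler_Q] by simp

lemma invertible_fund: "x \<in> X \<Longrightarrow> y \<noteq> 0 \<Longrightarrow> invertible (\<chi> i j. fund L i j x y)"
  using posdef by (intro posdef_invertible) simp

lemma fund_solve:
  assumes "x \<in> X" "y \<noteq> 0" "\<And>i. (\<Sum>r\<in>UNIV. fund L i r x y * v r) = a i"
  shows "(\<Sum>r\<in>UNIV. fund_inv L i r x y * a r) = v i"
  using matrix_inv_mult_vector[OF invertible_fund[OF assms(1,2)], of v a] assms(3)
  by (simp add: fund_inv_def)

lemma fund_lower:
  assumes "x \<in> X" "y \<noteq> 0"
  shows "(\<Sum>r\<in>UNIV. fund L i r x y * (\<Sum>j\<in>UNIV. fund_inv L r j x y * a j)) = a i"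
  using mult_matrix_inv_vector[OF invertible_fund[OF assms], of i a]
  by (simp add: fund_inv_def)

lemma fund_sym: "x \<in> X \<Longrightarrow> y \<noteq> 0 \<Longrightarrow> fund L i j x y = fund L j i x y"
  unfolding fund_def using dy_dy_commute[OF open_X smooth_Q] by simp

lemma dy_Q: "x \<in> X \<Longrightarrow> y \<noteq> 0 \<Longrightarrow> dy i Q x y = 2 * L x y * L1 L i x y"
  using smooth_field_diff[OF smooth_L] by (simp add: power2_eq_square dy_mult L1_def)

lemma fund_eq:
  assumes "x \<in> X" "y \<noteq> 0"
  shows "fund L i j x y = L1 L i x y * L1 L j x y + L x y * L2 L i j x y"
proof -
  have d: "field_diff L x y" "field_diff (L1 L i) x y" for i
    using smooth_field_diff smooth_L smooth_L123(1) assms by blast+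
  have "dy j (dy i Q) x y = dy j (\<lambda>x y. 2 * L x y * L1 L i x y) x y"
    using assms by (intro dy_cong dy_Q)
  also have "\<dots> = 2 * (L1 L i x y * L1 L j x y + L x y * L2 L i j x y)"
    by (simp add: dy_mult field_diff_mult field_diff_const dy_const d algebra_simps)
      (simp add: L1_def L2_def)
  finally show ?thesis
    using fund_sym[OF assms, of i j] by (simp add: fund_def)
qed

lemma fund_y:
  assumes "x \<in> X" "y \<noteq> 0"
  shows "(\<Sum>j\<in>UNIV. fund L i j x y * y $ j) = L x y * L1 L i x y"
proof -
  have "(\<Sum>j\<in>UNIV. fund L i j x y * y $ j) = 1/2 * (\<Sum>j\<in>UNIV. y $ j * dy j (dy i Q) x y)"
    using dy_dy_commute[OF open_X smooth_Q assms, of i] by (simp add: fund_def sum_distrib_left mult_ac)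
  then show ?thesis
    using eulerD[OF euler_dy_Q assms] dy_Q[OF assms] by simp
qed

lemma fund_half_dy: "fund L i j = (\<lambda>x y. 1/2 * dy i (dy j Q) x y)"
  by (simp add: fund_def fun_eq_iff)

text \<open>The field is half a third y-derivative of L^2, that is, twice the Cartan tensor C_ijk,
  which is totally symmetric.\<close>

lemma dy_fund_sym:
  assumes "x \<in> X" "y \<noteq> 0"
  shows "dy k (fund L i j) x y = dy j (fund L i k) x y"
proof -
  have s: "smooth_field X (dy i (dy j Q))" for i j
    by (intro smooth_field_dy open_X smooth_Q)
  have d: "dy k (fund L i j) x y = 1/2 * dy k (dy i (dy j Q)) x y" for i j k
    unfolding fund_half_dy
    by (subst dy_mult) (simp_all only: field_diff_const smooth_field_diff[OF s assms] dy_const)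
  have "dy k (dy i (dy j Q)) x y = dy k (dy j (dy i Q)) x y"
    using assms by (intro dy_cong dy_dy_commute[OF open_X smooth_Q])
  also have "\<dots> = dy j (dy k (dy i Q)) x y"
    by (rule dy_dy_commute[OF open_X smooth_dy_Q assms])
  also have "\<dots> = dy j (dy i (dy k Q)) x y"
    using assms by (intro dy_cong dy_dy_commute[OF open_X smooth_Q])
  finally show ?thesis by (simp add: d)
qed

text \<open>The components of g are homogeneous of degree 0 in y, and total symmetry lets the
  contracted index j take the role of the differentiation index.\<close>

lemma dy_fund_y:
  assumes "x \<in> X" "y \<noteq> 0"
  shows "(\<Sum>j\<in>UNIV. dy k (fund L i j) x y * y $ j) = 0"
proof -
  have s: "smooth_field X (dy i (dy k Q))"
    by (intro smooth_field_dy open_X smooth_Q)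
  have "euler X 0 (dy i (dy k Q))"
    using euler_dy[OF open_X smooth_dy_Q euler_dy_Q] by simp
  then have "(\<Sum>j\<in>UNIV. y $ j * dy j (dy i (dy k Q)) x y) = 0"
    using eulerD assms by fastforce
  moreover have "dy j (fund L i k) x y = 1/2 * dy j (dy i (dy k Q)) x y" for j
    unfolding fund_half_dy
    by (subst dy_mult) (simp_all only: field_diff_const smooth_field_diff[OF s assms] dy_const)
  then have "dy k (fund L i j) x y * y $ j = 1/2 * (y $ j * dy j (dy i (dy k Q)) x y)" for j
    using dy_fund_sym[OF assms, of k i j] by simp
  ultimately show ?thesis
    by (simp only: sum_distrib_left[symmetric] mult_zero_right)
qed

lemma L1_y: "x \<in> X \<Longrightarrow> y \<noteq> 0 \<Longrightarrow> (\<Sum>i\<in>UNIV. L1 L i x y * y $ i) = L x y"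
  using eulerD[OF euler_L] by (simp add: L1_def mult.commute)

lemma L2_sym: "x \<in> X \<Longrightarrow> y \<noteq> 0 \<Longrightarrow> L2 L i j x y = L2 L j i x y"
  using dy_dy_commute[OF open_X smooth_L] by (simp add: L1_def L2_def)

lemma L3_sym: "x \<in> X \<Longrightarrow> y \<noteq> 0 \<Longrightarrow> L3 L i j k x y = L3 L i k j x y"
  using dy_dy_commute[OF open_X smooth_L123(1)] by (simp add: L3_def L2_def)

lemma L2_y:
  assumes "x \<in> X" "y \<noteq> 0"
  shows "(\<Sum>j\<in>UNIV. L2 L i j x y * y $ j) = 0"
  using eulerD[OF euler_dy[OF open_X smooth_L euler_L] assms, of i]
  by (simp add: L2_def L1_def mult.commute)

lemma L3_y:
  assumes "x \<in> X" "y \<noteq> 0"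
  shows "(\<Sum>k\<in>UNIV. L3 L i j k x y * y $ k) = - L2 L i j x y"
  using eulerD[OF euler_dy[OF open_X smooth_field_dy[OF open_X smooth_L] euler_dy[OF open_X smooth_L euler_L]] assms, of j i]
  by (simp add: L3_def L2_def L1_def mult.commute)

section \<open>Spray and nonlinear connection\<close>

lemma spray_lower:
  assumes "x \<in> X" "y \<noteq> 0"
  shows "(\<Sum>r\<in>UNIV. fund L i r x y * spray L r x y)
    = 1/2 * ((\<Sum>k\<in>UNIV. y $ k * dx k (dy i Q) x y) - dx i Q x y)"
  using fund_lower[OF assms, of i "\<lambda>r. 1/2 * ((\<Sum>k\<in>UNIV. y $ k * dx k (dy r Q) x y) - dx r Q x y)"]
  by (simp add: spray_def sum_distrib_left sum_divide_distrib mult.assoc)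

text \<open>Cramer's rule, applied to the system in \<open>spray_lower\<close>, writes the spray as
  a quotient of determinants with differentiable entries and nonzero denominator. This justifies the
  product rule for g_ir S^r.\<close>

lemma spray_differentiable:
  assumes "x \<in> X" "y \<noteq> 0"
  shows "spray L i x differentiable at y"
proof -
  let ?G = "\<lambda>y. \<chi> i j. fund L i j x y"
  define a where "a = (\<lambda>i x y. 1/2 * ((\<Sum>k\<in>UNIV. y $ k * dx k (dy i Q) x y) + (- 1) * dx i Q x y))"
  have "field_diff (a i) x y" for i
    unfolding a_def
    by (intro field_diff_mult field_diff_add field_diff_sum field_diff_const field_diff_component finite
        smooth_field_diff[OF smooth_field_dx[OF open_X] assms] smooth_Q smooth_dy_Q)
  then have "a i x differentiable at y" for i by (simp add: field_diff_def)
  moreover have "fund L i j x differentiable at y" for i j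
    using smooth_field_diff[OF smooth_fund assms] by (simp add: field_diff_def)
  ultimately have "(\<lambda>y. if k = i then a j x y else fund L j k x y) differentiable at y" for j k
    by (cases "k = i") simp_all
  then have d: "(\<lambda>y. det (\<chi> j k. if k = i then a j x y else fund L j k x y)) differentiable at y"
    by (intro differentiable_det) simp
  have dG: "(\<lambda>y. det (?G y)) differentiable at y"
    using \<open>\<And>i j. fund L i j x differentiable at y\<close> by (intro differentiable_det) simp
  have G: "det (?G y) \<noteq> 0" if "y \<noteq> 0" for y
    using invertible_fund[OF assms(1) that] by (simp add: invertible_det_nz)
  have eq: "det (\<chi> j k. if k = i then a j x y else fund L j k x y) / det (?G y) = spray L i x y"
    if "y \<noteq> 0" for y
  proof -
    have "(?G y *v (\<chi> r. spray L r x y)) $ j = a j x y" for j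
      using spray_lower[OF assms(1) that] by (simp add: matrix_vector_mult_def a_def)
    then show ?thesis
      using cramer_lemma[of i "?G y" "\<chi> r. spray L r x y"] G[OF that] by (simp cong: if_cong)
  qed
  have "(\<lambda>y. det (\<chi> j k. if k = i then a j x y else fund L j k x y) / det (?G y)) differentiable at y"
    using d dG G[OF assms(2)] by (rule differentiable_divide)
  then show ?thesis
    unfolding differentiable_def
    using has_derivative_transform_within_open[of _ _ y UNIV "UNIV - {0}" "spray L i x"] eq assms(2)
    by (metis (no_types, lifting) Diff_iff UNIV_I open_UNIV open_delete singletonD singletonI)
qed

lemma fund_inv_sym:
  assumes "x \<in> X" "y \<noteq> 0"
  shows "fund_inv L i j x y = fund_inv L j i x y"
proof -
  have "transpose (\<chi> i j. fund L i j x y) = (\<chi> i j. fund L i j x y)"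
    using fund_sym[OF assms] by (simp add: transpose_def vec_eq_iff)
  from matrix_inv_sym[OF invertible_fund[OF assms] this]
  show ?thesis by (simp add: fund_inv_def transpose_def vec_eq_iff)
qed

lemma dy_dy_fund: "x \<in> X \<Longrightarrow> y \<noteq> 0 \<Longrightarrow> dy i (dy j Q) x y = 2 * fund L i j x y"
  by (simp add: fund_def)

lemma dx_fund:
  assumes "x \<in> X" "y \<noteq> 0"
  shows "dx k (dy i (dy j Q)) x y = 2 * dx k (fund L i j) x y"
proof -
  have "dx k (dy i (dy j Q)) x y = dx k (\<lambda>x y. 2 * fund L i j x y) x y"
    using open_X assms by (intro dx_cong[of X] dy_dy_fund) auto
  then show ?thesis
    by (simp add: dx_mult field_diff_const dx_const smooth_field_diff[OF smooth_fund assms])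
qed

lemma dx_dy_Q_y:
  assumes "x \<in> X" "y \<noteq> 0"
  shows "(\<Sum>j\<in>UNIV. y $ j * dx i (dy j Q) x y) = 2 * dx i Q x y"
  using eulerD[OF euler_dx[OF open_X smooth_Q euler_Q] assms, of i]
    dy_dx_commute[OF open_X smooth_Q assms] by simp

lemma dx_fund_y:
  assumes "x \<in> X" "y \<noteq> 0"
  shows "(\<Sum>j\<in>UNIV. y $ j * dx k (fund L i j) x y) = 1/2 * dx k (dy i Q) x y"
proof -
  have "dy j (dx k (dy i Q)) x y = 2 * dx k (fund L i j) x y" for j
  proof -
    have "dy j (dx k (dy i Q)) x y = dx k (dy j (dy i Q)) x y"
      by (rule dy_dx_commute[OF open_X smooth_dy_Q assms])
    also have "\<dots> = dx k (dy i (dy j Q)) x y"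
      using open_X assms by (intro dx_cong[of X] dy_dy_commute[OF open_X smooth_Q])
    finally show ?thesis using dx_fund[OF assms] by simp
  qed
  then show ?thesis
    using eulerD[OF euler_dx[OF open_X smooth_dy_Q euler_dy_Q] assms, of k i]
    by (simp add: sum_distrib_left[symmetric] mult.left_commute[of _ 2])
qed

text \<open>This is the y^j-derivative of \<open>spray_lower\<close>. The product rule on g_ir S^r
  gives 2 g_ir N^r_j and a Cartan tensor term, in which symmetry moves the differentiation to the
  index r. The result is free of the inverse matrix.\<close>

lemma nonlin_lower:
  assumes "x \<in> X" "y \<noteq> 0"
  shows "(\<Sum>r\<in>UNIV. fund L i r x y * nonlin L r j x y)
    = 1/4 * (dx j (dy i Q) x y - dx i (dy j Q) x y) + 1/2 * (\<Sum>k\<in>UNIV. y $ k * dx k (fund L i j) x y)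
      - 1/2 * (\<Sum>r\<in>UNIV. dy r (fund L i j) x y * spray L r x y)"
proof -
  note d = smooth_field_diff[OF smooth_field_dx[OF open_X] assms]
  have "dy j (\<lambda>x y. \<Sum>r\<in>UNIV. fund L i r x y * spray L r x y) x y
      = dy j (\<lambda>x y. 1/2 * ((\<Sum>k\<in>UNIV. y $ k * dx k (dy i Q) x y) + (- 1) * dx i Q x y)) x y"
    using assms(2) spray_lower[OF assms(1)] by (intro dy_cong) simp_all
  also have "\<dots> = 1/2 * ((\<Sum>k\<in>UNIV. y $ k * dy j (dx k (dy i Q)) x y
      + (if j = k then 1 else 0) * dx k (dy i Q) x y) - dy j (dx i Q) x y)"
    by (simp only: dy_mult dy_add dy_sum dy_const dy_component d smooth_Q smooth_dy_Q finite
        field_diff_mult field_diff_add field_diff_sum field_diff_const field_diff_component) simp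
  also have "(\<Sum>k\<in>UNIV. y $ k * dy j (dx k (dy i Q)) x y + (if j = k then 1 else 0) * dx k (dy i Q) x y)
      = (\<Sum>k\<in>UNIV. y $ k * dx k (dy j (dy i Q)) x y) + dx j (dy i Q) x y"
    using dy_dx_commute[OF open_X smooth_dy_Q assms]
    by (simp add: sum.distrib if_distrib[of "\<lambda>t. t * _"] cong: if_cong)
  also have "(\<Sum>k\<in>UNIV. y $ k * dx k (dy j (dy i Q)) x y) = 2 * (\<Sum>k\<in>UNIV. y $ k * dx k (fund L i j) x y)"
  proof -
    have "dx k (dy j (dy i Q)) x y = dx k (dy i (dy j Q)) x y" for k
      using open_X assms by (intro dx_cong[of X] dy_dy_commute[OF open_X smooth_Q])
    then show ?thesis
      using dx_fund[OF assms] by (simp add: sum_distrib_left mult.left_commute)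
  qed
  finally have 1: "dy j (\<lambda>x y. \<Sum>r\<in>UNIV. fund L i r x y * spray L r x y) x y =
      1/2 * (2 * (\<Sum>k\<in>UNIV. y $ k * dx k (fund L i j) x y) + dx j (dy i Q) x y - dx i (dy j Q) x y)"
    using dy_dx_commute[OF open_X smooth_Q assms] by simp
  have "fund L i r x differentiable at y" for r
    using smooth_field_diff[OF smooth_fund assms] by (simp add: field_diff_def)
  then have "dy j (\<lambda>x y. \<Sum>r\<in>UNIV. fund L i r x y * spray L r x y) x y
      = (\<Sum>r\<in>UNIV. fund L i r x y * dy j (spray L r) x y + dy j (fund L i r) x y * spray L r x y)"
    using spray_differentiable[OF assms] by (simp add: dy_def pd_sum pd_mult)
  also have "\<dots> = 2 * (\<Sum>r\<in>UNIV. fund L i r x y * nonlin L r j x y)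
      + (\<Sum>r\<in>UNIV. dy r (fund L i j) x y * spray L r x y)"
    using dy_fund_sym[OF assms, of j i]
    by (simp add: nonlin_def sum.distrib sum_distrib_left)
  finally show ?thesis using 1 by (simp add: field_simps)
qed

lemma fund_cancel:
  assumes "x \<in> X" "y \<noteq> 0"
    and "\<And>i. (\<Sum>r\<in>UNIV. fund L i r x y * v r) = (\<Sum>r\<in>UNIV. fund L i r x y * w r)"
  shows "v r = w r"
proof -
  let ?a = "\<lambda>i. \<Sum>r\<in>UNIV. fund L i r x y * w r"
  show ?thesis
    using fund_solve[OF assms, of r] fund_solve[of x y w ?a r] assms(1,2) by simp
qed

text \<open>Behind this is Euler's relation for the spray, which has degree 2. Instead of
  establishing the homogeneity of an expression with an inverse matrix, the proof compares the
  lowered forms; there the Cartan tensor term vanishes by \<open>dy_fund_y\<close>.\<close>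

lemma nonlin_y:
  assumes "x \<in> X" "y \<noteq> 0"
  shows "(\<Sum>j\<in>UNIV. nonlin L r j x y * y $ j) = spray L r x y"
proof (rule fund_cancel[OF assms])
  fix i
  have "(\<Sum>r\<in>UNIV. fund L i r x y * (\<Sum>j\<in>UNIV. nonlin L r j x y * y $ j))
      = (\<Sum>j\<in>UNIV. y $ j * (\<Sum>r\<in>UNIV. fund L i r x y * nonlin L r j x y))"
    unfolding sum_distrib_left by (subst sum.swap) (simp add: mult_ac)
  also have "\<dots> = 1/4 * ((\<Sum>j\<in>UNIV. y $ j * dx j (dy i Q) x y) - (\<Sum>j\<in>UNIV. y $ j * dx i (dy j Q) x y))
      + 1/2 * (\<Sum>j\<in>UNIV. y $ j * (\<Sum>k\<in>UNIV. y $ k * dx k (fund L i j) x y))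
      - 1/2 * (\<Sum>j\<in>UNIV. y $ j * (\<Sum>r\<in>UNIV. dy r (fund L i j) x y * spray L r x y))"
    unfolding nonlin_lower[OF assms]
    by (simp add: algebra_simps sum.distrib sum_subtractf sum_distrib_left)
  also have "(\<Sum>j\<in>UNIV. y $ j * (\<Sum>k\<in>UNIV. y $ k * dx k (fund L i j) x y))
      = (\<Sum>k\<in>UNIV. y $ k * (\<Sum>j\<in>UNIV. y $ j * dx k (fund L i j) x y))"
    unfolding sum_distrib_left by (subst sum.swap) (simp add: mult_ac)
  also have "\<dots> = 1/2 * (\<Sum>k\<in>UNIV. y $ k * dx k (dy i Q) x y)"
    unfolding dx_fund_y[OF assms] by (simp add: sum_distrib_left mult_ac)
  also have "(\<Sum>j\<in>UNIV. y $ j * (\<Sum>r\<in>UNIV. dy r (fund L i j) x y * spray L r x y))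
      = (\<Sum>r\<in>UNIV. spray L r x y * (\<Sum>j\<in>UNIV. dy r (fund L i j) x y * y $ j))"
    unfolding sum_distrib_left by (subst sum.swap) (simp add: mult_ac)
  also have "\<dots> = 0"
    by (simp add: dy_fund_y[OF assms])
  finally show "(\<Sum>r\<in>UNIV. fund L i r x y * (\<Sum>j\<in>UNIV. nonlin L r j x y * y $ j))
      = (\<Sum>r\<in>UNIV. fund L i r x y * spray L r x y)"
    unfolding spray_lower[OF assms] dx_dy_Q_y[OF assms] by (simp add: field_simps)
qed

section \<open>Cartan coefficients and h-parallel objects\<close>

lemma delta_fund_sym: "x \<in> X \<Longrightarrow> y \<noteq> 0 \<Longrightarrow> delta L k (fund L i j) x y = delta L k (fund L j i) x y"
  using open_X by (intro delta_cong[of X] fund_sym)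

lemma cartan_sym: "x \<in> X \<Longrightarrow> y \<noteq> 0 \<Longrightarrow> cartan L i j k x y = cartan L i k j x y"
  using delta_fund_sym[of x y _ j k] by (simp add: cartan_def add.commute)

lemma cartan_lower:
  assumes "x \<in> X" "y \<noteq> 0"
  shows "(\<Sum>r\<in>UNIV. fund L i r x y * cartan L r j k x y)
    = 1/2 * (delta L j (fund L i k) x y + delta L k (fund L i j) x y - delta L i (fund L j k) x y)"
  using fund_lower[OF assms, of i "\<lambda>r. 1/2 * (delta L j (fund L r k) x y
      + delta L k (fund L r j) x y - delta L r (fund L j k) x y)"]
  by (simp add: cartan_def sum_distrib_left sum_divide_distrib mult.assoc)

text \<open>This is g_ij|k = 0. In the sum of the two Christoffel expressions the
  \<open>delta L i\<close> and \<open>delta L j\<close> terms cancel, and the two halves of the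
  \<open>delta L k\<close> term add up.\<close>

lemma delta_fund:
  assumes "x \<in> X" "y \<noteq> 0"
  shows "delta L k (fund L i j) x y
    = (\<Sum>r\<in>UNIV. fund L i r x y * cartan L r j k x y) + (\<Sum>r\<in>UNIV. fund L j r x y * cartan L r i k x y)"
  unfolding cartan_lower[OF assms]
  using delta_fund_sym[OF assms, of k i j] by (simp add: field_simps)

text \<open>Gamma is built from N through \<open>delta\<close>; contraction with y gives N back.
  With the symmetry of Gamma this makes y itself h-parallel, since \<open>delta L k\<close> takes
  y^j to -N^j_k.\<close>

lemma cartan_y:
  assumes "x \<in> X" "y \<noteq> 0"
  shows "(\<Sum>k\<in>UNIV. cartan L r j k x y * y $ k) = nonlin L r j x y"
proof (rule fund_cancel[OF assms, of "\<lambda>r. \<Sum>k\<in>UNIV. cartan L r j k x y * y $ k" "\<lambda>r. nonlin L r j x y"])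
  fix i
  \<comment> \<open>When y is contracted into an index of g, the N-part of \<open>delta\<close>
    drops out by \<open>dy_fund_y\<close>.\<close>
  have A: "(\<Sum>k\<in>UNIV. y $ k * delta L j (fund L i k) x y) = 1/2 * dx j (dy i Q) x y" for i j
  proof -
    have "(\<Sum>k\<in>UNIV. y $ k * (\<Sum>r\<in>UNIV. nonlin L r j x y * dy r (fund L i k) x y))
        = (\<Sum>r\<in>UNIV. nonlin L r j x y * (\<Sum>k\<in>UNIV. dy r (fund L i k) x y * y $ k))"
      unfolding sum_distrib_left by (subst sum.swap) (simp add: mult_ac)
    then show ?thesis
      using dx_fund_y[OF assms]
      by (simp add: delta_def right_diff_distrib sum_subtractf dy_fund_y[OF assms])
  qed
  \<comment> \<open>When y is contracted into the direction of \<open>delta\<close>, N becomes the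
    spray, which reproduces the last term of \<open>nonlin_lower\<close>.\<close>
  have "(\<Sum>k\<in>UNIV. y $ k * (\<Sum>r\<in>UNIV. nonlin L r k x y * dy r (fund L i j) x y))
      = (\<Sum>r\<in>UNIV. (\<Sum>k\<in>UNIV. nonlin L r k x y * y $ k) * dy r (fund L i j) x y)"
    unfolding sum_distrib_left sum_distrib_right by (subst sum.swap) (simp add: mult_ac)
  then have "(\<Sum>k\<in>UNIV. y $ k * (\<Sum>r\<in>UNIV. nonlin L r k x y * dy r (fund L i j) x y))
      = (\<Sum>r\<in>UNIV. dy r (fund L i j) x y * spray L r x y)"
    unfolding nonlin_y[OF assms] by (simp add: mult.commute)
  then have B: "(\<Sum>k\<in>UNIV. y $ k * delta L k (fund L i j) x y)
      = (\<Sum>k\<in>UNIV. y $ k * dx k (fund L i j) x y) - (\<Sum>r\<in>UNIV. dy r (fund L i j) x y * spray L r x y)"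
    by (simp add: delta_def right_diff_distrib sum_subtractf)
  have "(\<Sum>r\<in>UNIV. fund L i r x y * (\<Sum>k\<in>UNIV. cartan L r j k x y * y $ k))
      = (\<Sum>k\<in>UNIV. y $ k * (\<Sum>r\<in>UNIV. fund L i r x y * cartan L r j k x y))"
    unfolding sum_distrib_left by (subst sum.swap) (simp add: mult_ac)
  also have "\<dots> = 1/2 * ((\<Sum>k\<in>UNIV. y $ k * delta L j (fund L i k) x y)
      + (\<Sum>k\<in>UNIV. y $ k * delta L k (fund L i j) x y) - (\<Sum>k\<in>UNIV. y $ k * delta L i (fund L j k) x y))"
    unfolding cartan_lower[OF assms]
    by (simp add: algebra_simps sum.distrib sum_subtractf sum_divide_distrib add_divide_distrib diff_divide_distrib)
  finally show "(\<Sum>r\<in>UNIV. fund L i r x y * (\<Sum>k\<in>UNIV. cartan L r j k x y * y $ k))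
      = (\<Sum>r\<in>UNIV. fund L i r x y * nonlin L r j x y)"
    unfolding A B nonlin_lower[OF assms] by (simp add: field_simps)
qed

lemma cartan_y':
  "x \<in> X \<Longrightarrow> y \<noteq> 0 \<Longrightarrow> (\<Sum>j\<in>UNIV. cartan L r j k x y * y $ j) = nonlin L r k x y"
  using cartan_y[of x y r k] cartan_sym[of x y r _ k] by simp

text \<open>L L_i = g_ik y^k is a contraction of two h-parallel objects, g and y. The factors are
  separated afterwards: first L is shown to be parallel, then L_i, and finally L_ij by way of g_ij =
  L_i L_j + L L_ij.\<close>

lemma delta_L_L1:
  assumes "x \<in> X" "y \<noteq> 0"
  shows "delta L j (\<lambda>x y. L x y * L1 L i x y) x y
    = (\<Sum>r\<in>UNIV. L x y * L1 L r x y * cartan L r i j x y)"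
proof -
  have "delta L j (\<lambda>x y. L x y * L1 L i x y) x y = delta L j (\<lambda>x y. \<Sum>k\<in>UNIV. fund L i k x y * y $ k) x y"
    using open_X assms fund_y by (intro delta_cong[of X]) auto
  also have "\<dots> = (\<Sum>k\<in>UNIV. fund L i k x y * - nonlin L k j x y + delta L j (fund L i k) x y * y $ k)"
    by (simp add: delta_sum delta_mult delta_component field_diff_mult field_diff_component
        smooth_field_diff[OF smooth_fund assms])
  also have "\<dots> = - (\<Sum>k\<in>UNIV. fund L i k x y * nonlin L k j x y)
      + (\<Sum>k\<in>UNIV. (\<Sum>r\<in>UNIV. fund L i r x y * cartan L r k j x y) * y $ k)
      + (\<Sum>k\<in>UNIV. (\<Sum>r\<in>UNIV. fund L k r x y * cartan L r i j x y) * y $ k)"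
    by (simp add: sum.distrib sum_subtractf delta_fund[OF assms, of j i] distrib_right)
  also have "(\<Sum>k\<in>UNIV. (\<Sum>r\<in>UNIV. fund L i r x y * cartan L r k j x y) * y $ k)
      = (\<Sum>r\<in>UNIV. fund L i r x y * (\<Sum>k\<in>UNIV. cartan L r k j x y * y $ k))"
    unfolding sum_distrib_left sum_distrib_right by (subst sum.swap) (simp add: mult_ac)
  also have "(\<Sum>k\<in>UNIV. (\<Sum>r\<in>UNIV. fund L k r x y * cartan L r i j x y) * y $ k)
      = (\<Sum>r\<in>UNIV. (\<Sum>k\<in>UNIV. fund L r k x y * y $ k) * cartan L r i j x y)"
    unfolding sum_distrib_right by (subst sum.swap) (simp add: mult_ac fund_sym[OF assms])
  finally show ?thesis
    by (simp add: cartan_y'[OF assms] fund_y[OF assms])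
qed

text \<open>L^2 = (L L_i) y^i is again a contraction of parallel objects, so 2 L times the
  derivative of L vanishes, and L is positive.\<close>

lemma delta_L:
  assumes "x \<in> X" "y \<noteq> 0"
  shows "delta L j L x y = 0"
proof -
  have d: "field_diff L x y" "field_diff (L1 L i) x y" for i
    using smooth_field_diff smooth_L smooth_L123(1) assms by blast+
  have "2 * L x y * delta L j L x y = delta L j (\<lambda>x y. L x y * L x y) x y"
    by (simp add: delta_mult d)
  also have "\<dots> = delta L j (\<lambda>x y. \<Sum>i\<in>UNIV. L x y * L1 L i x y * y $ i) x y"
    using open_X assms L1_y by (intro delta_cong[of X]) (auto simp: mult.assoc simp flip: sum_distrib_left)
  also have "\<dots> = (\<Sum>i\<in>UNIV. L x y * L1 L i x y * - nonlin L i j x y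
      + (\<Sum>r\<in>UNIV. L x y * L1 L r x y * cartan L r i j x y) * y $ i)"
    using delta_L_L1[OF assms, of j]
    by (simp add: delta_sum delta_mult[of "\<lambda>x y. L x y * L1 L _ x y"] delta_component field_diff_mult field_diff_component d)
  also have "\<dots> = - (\<Sum>i\<in>UNIV. L x y * L1 L i x y * nonlin L i j x y)
      + (\<Sum>i\<in>UNIV. (\<Sum>r\<in>UNIV. L x y * L1 L r x y * cartan L r i j x y) * y $ i)"
    by (simp add: sum.distrib sum_subtractf)
  also have "(\<Sum>i\<in>UNIV. (\<Sum>r\<in>UNIV. L x y * L1 L r x y * cartan L r i j x y) * y $ i)
      = (\<Sum>r\<in>UNIV. L x y * L1 L r x y * (\<Sum>i\<in>UNIV. cartan L r i j x y * y $ i))"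
    unfolding sum_distrib_left sum_distrib_right by (subst sum.swap) (simp add: mult_ac)
  finally show ?thesis
    using pos[OF assms] by (simp add: cartan_y'[OF assms])
qed

lemma delta_L1:
  assumes "x \<in> X" "y \<noteq> 0"
  shows "delta L j (L1 L i) x y = (\<Sum>r\<in>UNIV. L1 L r x y * cartan L r i j x y)"
proof -
  have d: "field_diff L x y" "field_diff (L1 L i) x y" for i
    using smooth_field_diff smooth_L smooth_L123(1) assms by blast+
  have "L x y * delta L j (L1 L i) x y = L x y * (\<Sum>r\<in>UNIV. L1 L r x y * cartan L r i j x y)"
    using delta_L_L1[OF assms, of j i]
    by (simp add: delta_mult d delta_L[OF assms] sum_distrib_left mult.assoc)
  then show ?thesis using pos[OF assms] by simp
qed

lemma delta_L2:
  assumes "x \<in> X" "y \<noteq> 0"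
  shows "delta L k (L2 L i j) x y
    = (\<Sum>r\<in>UNIV. L2 L i r x y * cartan L r j k x y) + (\<Sum>r\<in>UNIV. L2 L j r x y * cartan L r i k x y)"
proof -
  have d: "field_diff L x y" "field_diff (L1 L i) x y" "field_diff (L2 L i j) x y" for i j
    using smooth_field_diff smooth_L smooth_L123 assms by blast+
  have "delta L k (fund L i j) x y = delta L k (\<lambda>x y. L1 L i x y * L1 L j x y + L x y * L2 L i j x y) x y"
    using open_X assms by (intro delta_cong[of X] fund_eq)
  also have "\<dots> = L1 L i x y * delta L k (L1 L j) x y + delta L k (L1 L i) x y * L1 L j x y
      + L x y * delta L k (L2 L i j) x y"
    by (simp add: delta_add delta_mult field_diff_mult d delta_L[OF assms])
  finally have "L x y * delta L k (L2 L i j) x y = L x y *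
    ((\<Sum>r\<in>UNIV. L2 L i r x y * cartan L r j k x y) + (\<Sum>r\<in>UNIV. L2 L j r x y * cartan L r i k x y))"
    unfolding delta_fund[OF assms] fund_eq[OF assms] delta_L1[OF assms]
    by (simp add: algebra_simps sum.distrib sum_distrib_left)
  then show ?thesis using pos[OF assms] by simp
qed

end

section \<open>The difference of the Cartan connections\<close>

text \<open>\<open>Lb\<close> is a separate function that agrees with \<open>Lbar\<close> over X:
  the changed metric comes from the tangent bundle, and its coordinate formula is available on the
  chart image only.\<close>

locale beta_change_chart = finsler_chart X L + bar: finsler_chart X Lb
  for X :: "(real^'n::finite) set" and L Lb :: "'n field" +
  fixes s :: "'n base_fun" and b :: "'n base_form"
  assumes Lb_eq: "\<And>x y. x \<in> X \<Longrightarrow> Lb x y = Lbar L s b x y"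
    and s_diff: "\<And>x. x \<in> X \<Longrightarrow> s differentiable at x"
    and b_diff: "\<And>x i. x \<in> X \<Longrightarrow> (\<lambda>x. b x $ i) differentiable at x"
begin

text \<open>\<open>DC\<close>, \<open>DC0\<close> and \<open>DC00\<close> are the true difference
  tensor and its contractions, to be kept apart from the explicit expressions \<open>D\<close>,
  \<open>D0\<close> and \<open>D00\<close>. Agreement is shown for \<open>D00\<close> first, since
  \<open>D0\<close> is written in terms of \<open>D00\<close>, and \<open>D\<close> in terms of
  \<open>D0\<close>.\<close>

definition DC :: "'n \<Rightarrow> 'n \<Rightarrow> 'n \<Rightarrow> 'n field" where
  "DC i j k x y = cartan Lb i j k x y - cartan L i j k x y"

definition DC0 :: "'n \<Rightarrow> 'n \<Rightarrow> 'n field" where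
  "DC0 i j x y = (\<Sum>k\<in>UNIV. DC i k j x y * y $ k)"

definition DC00 :: "'n \<Rightarrow> 'n field" where
  "DC00 i x y = (\<Sum>j\<in>UNIV. DC0 i j x y * y $ j)"

lemma DC00_sum: "DC00 r x y = (\<Sum>j\<in>UNIV. \<Sum>k\<in>UNIV. DC r j k x y * y $ j * y $ k)"
  unfolding DC00_def DC0_def sum_distrib_right by (rule sum.swap)

lemma DC_sym: "x \<in> X \<Longrightarrow> y \<noteq> 0 \<Longrightarrow> DC i j k x y = DC i k j x y"
  unfolding DC_def using cartan_sym bar.cartan_sym by simp

lemma DC0_nonlin: "x \<in> X \<Longrightarrow> y \<noteq> 0 \<Longrightarrow> DC0 i j x y = nonlin Lb i j x y - nonlin L i j x y"
  unfolding DC0_def DC_def by (simp add: left_diff_distrib sum_subtractf cartan_y' bar.cartan_y')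

text \<open>Contracting the difference of the Gammas with y gives the difference of the N. Hence the
  two horizontal derivatives differ by a vertical one with coefficients D^r_0k, which is how these
  enter the equations below.\<close>

lemma delta_bar:
  "x \<in> X \<Longrightarrow> y \<noteq> 0 \<Longrightarrow> delta Lb k f x y = delta L k f x y - (\<Sum>r\<in>UNIV. DC0 r k x y * dy r f x y)"
  by (simp add: delta_def DC0_nonlin left_diff_distrib sum_subtractf)

section \<open>Equations for the difference tensor\<close>

lemma exp_s_diff: "x \<in> X \<Longrightarrow> field_diff (\<lambda>x y. exp (s x)) x y"
proof (rule field_diff_base)
  assume "x \<in> X"
  then show "(\<lambda>x. exp (s x)) differentiable at x"
    using s_diff has_derivative_exp unfolding differentiable_def by blast
qed

lemma L1_bar:
  assumes "x \<in> X" "y \<noteq> 0"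
  shows "L1 Lb i x y = exp (s x) * L1 L i x y + b x $ i"
proof -
  have "L1 Lb i x y = dy i (\<lambda>x y. exp (s x) * L x y + (\<Sum>j\<in>UNIV. b x $ j * y $ j)) x y"
    unfolding L1_def using assms Lb_eq by (intro dy_cong) (simp_all add: Lbar_def)
  also have "\<dots> = exp (s x) * L1 L i x y + (\<Sum>j\<in>UNIV. b x $ j * (if i = j then 1 else 0))"
    using b_diff[OF assms(1)]
    by (simp only: dy_add dy_mult dy_sum dy_base dy_component field_diff_add field_diff_mult field_diff_sum finite
        field_diff_base field_diff_component exp_s_diff[OF assms(1)] smooth_field_diff[OF smooth_L assms])
      (simp add: L1_def)
  finally show ?thesis by (simp add: if_distrib cong: if_cong)
qed

lemma dy_L1_bar:
  assumes "x \<in> X" "y \<noteq> 0"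
  shows "dy r (\<lambda>x y. exp (s x) * L1 L i x y + b x $ i) x y = exp (s x) * L2 L i r x y"
  using b_diff[OF assms(1)]
  by (simp add: L2_def dy_add dy_mult dy_base field_diff_mult field_diff_base exp_s_diff[OF assms(1)]
      smooth_field_diff[OF smooth_L123(1) assms])

lemma L2_bar:
  assumes "x \<in> X" "y \<noteq> 0"
  shows "L2 Lb i j x y = exp (s x) * L2 L i j x y"
proof -
  have "L2 Lb i j x y = dy j (\<lambda>x y. exp (s x) * L1 L i x y + b x $ i) x y"
    unfolding L2_def using assms L1_bar by (intro dy_cong) simp_all
  then show ?thesis using dy_L1_bar[OF assms] by simp
qed

lemma delta_exp_s: "x \<in> X \<Longrightarrow> delta L k (\<lambda>x y. exp (s x)) x y = exp (s x) * pd k s x"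
  by (simp add: delta_base pd_exp s_diff)

text \<open>The h-parallelism of Lbar_i = e^sigma L_i + b_i is compared with that of L_i; what b
  contributes is collected in \<open>b_cov\<close>. The left side is symmetric in i and j although
  the terms on the right are not, so symmetrizing brings in E and antisymmetrizing brings in
  F.\<close>

lemma L1_bar_DC:
  assumes xy: "x \<in> X" "y \<noteq> 0"
  shows "(\<Sum>r\<in>UNIV. L1 Lb r x y * DC r i j x y) = b_cov L b i j x y
    + exp (s x) * (pd j s x * L1 L i x y - (\<Sum>r\<in>UNIV. L2 L i r x y * DC0 r j x y))"
proof -
  let ?f = "\<lambda>x y. exp (s x) * L1 L i x y + b x $ i"
  have "(\<Sum>r\<in>UNIV. L1 Lb r x y * cartan Lb r i j x y) = delta Lb j ?f x y"
    using bar.delta_L1[OF xy, of j i] open_X xy L1_bar delta_cong[of X x y "L1 Lb i" ?f Lb j] by simp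
  also have "\<dots> = delta L j ?f x y - exp (s x) * (\<Sum>r\<in>UNIV. L2 L i r x y * DC0 r j x y)"
    by (simp add: delta_bar[OF xy] dy_L1_bar[OF xy] sum_distrib_left mult_ac)
  also have "delta L j ?f x y = exp (s x) * (\<Sum>r\<in>UNIV. L1 L r x y * cartan L r i j x y)
      + exp (s x) * pd j s x * L1 L i x y + delta L j (\<lambda>x y. b x $ i) x y"
    using b_diff[OF xy(1)]
    by (simp add: delta_add delta_mult field_diff_mult field_diff_base exp_s_diff[OF xy(1)]
        smooth_field_diff[OF smooth_L123(1) xy] delta_L1[OF xy] delta_exp_s[OF xy(1)])
  finally show ?thesis
    by (simp add: DC_def b_cov_def L1_bar[OF xy] algebra_simps sum.distrib sum_subtractf sum_distrib_left)
qed

lemma L2_DC_sum: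
  assumes xy: "x \<in> X" "y \<noteq> 0"
  shows "(\<Sum>r\<in>UNIV. L2 L i r x y * DC r j k x y) + (\<Sum>r\<in>UNIV. L2 L j r x y * DC r i k x y)
    = pd k s x * L2 L i j x y - (\<Sum>r\<in>UNIV. L3 L i j r x y * DC0 r k x y)"
proof -
  let ?f = "\<lambda>x y. exp (s x) * L2 L i j x y"
  note d = exp_s_diff[OF xy(1)] smooth_field_diff[OF smooth_L123(2) xy]
  have dyf: "dy r ?f x y = exp (s x) * L3 L i j r x y" for r
    by (simp add: L3_def dy_mult dy_base d)
  have "exp (s x) * ((\<Sum>r\<in>UNIV. L2 L i r x y * cartan Lb r j k x y) + (\<Sum>r\<in>UNIV. L2 L j r x y * cartan Lb r i k x y))
      = delta Lb k (L2 Lb i j) x y"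
    unfolding bar.delta_L2[OF xy] L2_bar[OF xy] by (simp add: sum_distrib_left distrib_left mult.assoc)
  also have "\<dots> = delta Lb k ?f x y"
    using open_X xy L2_bar by (intro delta_cong[of X]) auto
  also have "\<dots> = delta L k ?f x y - exp (s x) * (\<Sum>r\<in>UNIV. L3 L i j r x y * DC0 r k x y)"
    by (simp add: delta_bar[OF xy] dyf sum_distrib_left mult_ac)
  also have "delta L k ?f x y = exp (s x) * ((\<Sum>r\<in>UNIV. L2 L i r x y * cartan L r j k x y)
      + (\<Sum>r\<in>UNIV. L2 L j r x y * cartan L r i k x y) + pd k s x * L2 L i j x y)"
    by (simp add: delta_mult d delta_L2[OF xy] delta_exp_s[OF xy(1)] distrib_left mult.assoc)
  finally have "exp (s x) * ((\<Sum>r\<in>UNIV. L2 L i r x y * cartan Lb r j k x y) + (\<Sum>r\<in>UNIV. L2 L j r x y * cartan Lb r i k x y))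
    = exp (s x) * ((\<Sum>r\<in>UNIV. L2 L i r x y * cartan L r j k x y) + (\<Sum>r\<in>UNIV. L2 L j r x y * cartan L r i k x y)
      + pd k s x * L2 L i j x y - (\<Sum>r\<in>UNIV. L3 L i j r x y * DC0 r k x y))"
    by (simp only: right_diff_distrib)
  then have "(\<Sum>r\<in>UNIV. L2 L i r x y * cartan Lb r j k x y) + (\<Sum>r\<in>UNIV. L2 L j r x y * cartan Lb r i k x y)
    = (\<Sum>r\<in>UNIV. L2 L i r x y * cartan L r j k x y) + (\<Sum>r\<in>UNIV. L2 L j r x y * cartan L r i k x y)
      + pd k s x * L2 L i j x y - (\<Sum>r\<in>UNIV. L3 L i j r x y * DC0 r k x y)"
    by simp
  then show ?thesis
    by (simp add: DC_def right_diff_distrib sum_subtractf)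
qed

lemma L2_DC:
  assumes xy: "x \<in> X" "y \<noteq> 0"
  shows "(\<Sum>r\<in>UNIV. L2 L i r x y * DC r j k x y) = 1/2 *
     ((\<Sum>r\<in>UNIV. L3 L j k r x y * DC0 r i x y)
      - (\<Sum>r\<in>UNIV. L3 L i j r x y * DC0 r k x y)
      - (\<Sum>r\<in>UNIV. L3 L i k r x y * DC0 r j x y)
      + pd j s x * L2 L i k x y + pd k s x * L2 L i j x y - pd i s x * L2 L j k x y)"
proof -
  have "(\<Sum>r\<in>UNIV. L2 L i r x y * DC r j k x y) = (\<Sum>r\<in>UNIV. L2 L i r x y * DC r k j x y)" for i j k
    using DC_sym[OF xy, of _ j k] by simp
  \<comment> \<open>These symmetries identify in pairs the six sums in the three instances of
    \<open>L2_DC_sum\<close>. Adding the first two instances and subtracting the third leaves twice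
    the wanted sum.\<close>
  note this[of i j k] this[of j i k] this[of k i j]
  then show ?thesis
    using L2_DC_sum[OF xy, of i j k] L2_DC_sum[OF xy, of i k j] L2_DC_sum[OF xy, of j k i] by argo
qed

lemma L1_bar_DC_sym:
  assumes xy: "x \<in> X" "y \<noteq> 0"
  shows "(\<Sum>r\<in>UNIV. L1 Lb r x y * DC r i j x y) = E L b i j x y - 1/2 * exp (s x) *
         ((\<Sum>r\<in>UNIV. L2 L i r x y * DC0 r j x y) + (\<Sum>r\<in>UNIV. L2 L j r x y * DC0 r i x y)
          - sigma2 L s i j x y)"
proof -
  have "(\<Sum>r\<in>UNIV. L1 Lb r x y * DC r i j x y) = (\<Sum>r\<in>UNIV. L1 Lb r x y * DC r j i x y)"
    using DC_sym[OF xy, of _ i j] by simp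
  then show ?thesis
    using L1_bar_DC[OF xy, of i j] L1_bar_DC[OF xy, of j i]
    by (simp add: E_def sigma2_def field_simps)
qed

section \<open>Contractions with y\<close>

lemma DC0_y: "x \<in> X \<Longrightarrow> y \<noteq> 0 \<Longrightarrow> (\<Sum>k\<in>UNIV. DC i j k x y * y $ k) = DC0 i j x y"
  unfolding DC0_def using DC_sym[of x y i j] by simp

lemma L2_DC0_sum:
  assumes xy: "x \<in> X" "y \<noteq> 0"
  shows "(\<Sum>r\<in>UNIV. L2 L i r x y * DC0 r j x y) + (\<Sum>r\<in>UNIV. L2 L j r x y * DC0 r i x y)
    = sigma0 s x y * L2 L i j x y - (\<Sum>r\<in>UNIV. L3 L i j r x y * DC00 r x y)"
proof -
  have 1: "(\<Sum>r\<in>UNIV. L2 L i r x y * DC0 r j x y) = (\<Sum>k\<in>UNIV. (\<Sum>r\<in>UNIV. L2 L i r x y * DC r j k x y) * y $ k)" for i j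
    unfolding DC0_y[OF xy, symmetric] sum_distrib_left sum_distrib_right
    by (subst sum.swap) (simp add: mult_ac)
  have 2: "(\<Sum>r\<in>UNIV. L3 L i j r x y * DC00 r x y) = (\<Sum>k\<in>UNIV. (\<Sum>r\<in>UNIV. L3 L i j r x y * DC0 r k x y) * y $ k)"
    unfolding DC00_def sum_distrib_left sum_distrib_right
    by (subst sum.swap) (simp add: mult_ac)
  have 3: "sigma0 s x y * L2 L i j x y = (\<Sum>k\<in>UNIV. pd k s x * L2 L i j x y * y $ k)"
    by (simp add: sigma0_def sum_distrib_left sum_distrib_right mult_ac)
  have "(\<Sum>r\<in>UNIV. L2 L i r x y * DC0 r j x y) + (\<Sum>r\<in>UNIV. L2 L j r x y * DC0 r i x y)
    = (\<Sum>k\<in>UNIV. ((\<Sum>r\<in>UNIV. L2 L i r x y * DC r j k x y) + (\<Sum>r\<in>UNIV. L2 L j r x y * DC r i k x y)) * y $ k)"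
    unfolding 1 by (simp add: distrib_right sum.distrib)
  then show ?thesis
    unfolding L2_DC_sum[OF xy] 2 3 by (simp only: left_diff_distrib sum_subtractf)
qed

lemma L2_DC0:
  assumes xy: "x \<in> X" "y \<noteq> 0"
  shows "(\<Sum>r\<in>UNIV. L2 L i r x y * DC0 r j x y) = exp (- s x) * F L b i j x y
     - 1/2 * (\<Sum>r\<in>UNIV. L3 L i j r x y * DC00 r x y)
     + 1/2 * (sigma0 s x y * L2 L i j x y - mu L s i j x y)"
proof -
  \<comment> \<open>The contracted equation gives p + q only. The difference p - q comes from
    subtracting two instances of \<open>L1_bar_DC\<close> whose left sides agree.\<close>
  define p q where "p = (\<Sum>r\<in>UNIV. L2 L i r x y * DC0 r j x y)" "q = (\<Sum>r\<in>UNIV. L2 L j r x y * DC0 r i x y)"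
  have "(\<Sum>r\<in>UNIV. L1 Lb r x y * DC r i j x y) = (\<Sum>r\<in>UNIV. L1 Lb r x y * DC r j i x y)"
    using DC_sym[OF xy, of _ i j] by simp
  then have "2 * F L b i j x y = exp (s x) * (mu L s i j x y + p - q)"
    using L1_bar_DC[OF xy, of i j] L1_bar_DC[OF xy, of j i]
    by (simp add: F_def mu_def p_q_def algebra_simps)
  then have "2 * exp (- s x) * F L b i j x y = mu L s i j x y + p - q"
    by (simp add: exp_minus field_simps)
  moreover have "p + q = sigma0 s x y * L2 L i j x y - (\<Sum>r\<in>UNIV. L3 L i j r x y * DC00 r x y)"
    using L2_DC0_sum[OF xy] by (simp add: p_q_def)
  ultimately show ?thesis unfolding p_q_def by (simp add: field_simps)
qed

lemma L1_bar_DC0: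
  assumes xy: "x \<in> X" "y \<noteq> 0"
  shows "(\<Sum>r\<in>UNIV. L1 Lb r x y * DC0 r j x y) = E0 L b j x y
     - 1/2 * exp (s x) * (\<Sum>r\<in>UNIV. L2 L j r x y * DC00 r x y)
     + 1/2 * exp (s x) * (sigma0 s x y * L1 L j x y + pd j s x * L x y)"
proof -
  \<comment> \<open>Stated for abstract families, so that the contraction distributes over the terms
    while the inner sums over r stay folded for separate evaluation.\<close>
  have lin: "(\<Sum>k\<in>UNIV. (e k - 1/2 * exp (s x) * (p k + q k - r k)) * y $ k) = (\<Sum>k\<in>UNIV. e k * y $ k)
      - 1/2 * exp (s x) * ((\<Sum>k\<in>UNIV. p k * y $ k) + (\<Sum>k\<in>UNIV. q k * y $ k) - (\<Sum>k\<in>UNIV. r k * y $ k))"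
    for e p q r :: "'n \<Rightarrow> real"
    by (simp add: algebra_simps sum.distrib sum_subtractf sum_distrib_left sum_divide_distrib add_divide_distrib)
  have "(\<Sum>r\<in>UNIV. L1 Lb r x y * DC0 r j x y) = (\<Sum>k\<in>UNIV. (\<Sum>r\<in>UNIV. L1 Lb r x y * DC r k j x y) * y $ k)"
    unfolding DC0_def sum_distrib_left sum_distrib_right
    by (subst sum.swap) (simp add: mult_ac)
  also have "\<dots> = E0 L b j x y - 1/2 * exp (s x) *
      ((\<Sum>k\<in>UNIV. (\<Sum>r\<in>UNIV. L2 L k r x y * DC0 r j x y) * y $ k)
      + (\<Sum>k\<in>UNIV. (\<Sum>r\<in>UNIV. L2 L j r x y * DC0 r k x y) * y $ k)
      - (\<Sum>k\<in>UNIV. sigma2 L s k j x y * y $ k))"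
    unfolding L1_bar_DC_sym[OF xy] E0_def by (rule lin)
  also have "(\<Sum>k\<in>UNIV. (\<Sum>r\<in>UNIV. L2 L k r x y * DC0 r j x y) * y $ k)
      = (\<Sum>r\<in>UNIV. DC0 r j x y * (\<Sum>k\<in>UNIV. L2 L r k x y * y $ k))"
    unfolding sum_distrib_left sum_distrib_right
    by (subst sum.swap) (simp add: mult_ac L2_sym[OF xy])
  also have "\<dots> = 0" by (simp add: L2_y[OF xy])
  also have "(\<Sum>k\<in>UNIV. (\<Sum>r\<in>UNIV. L2 L j r x y * DC0 r k x y) * y $ k) = (\<Sum>r\<in>UNIV. L2 L j r x y * DC00 r x y)"
    unfolding DC00_def sum_distrib_left sum_distrib_right
    by (subst sum.swap) (simp add: mult_ac)
  also have "(\<Sum>k\<in>UNIV. sigma2 L s k j x y * y $ k) = sigma0 s x y * L1 L j x y + pd j s x * L x y"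
    by (simp add: sigma2_def sigma0_def L1_y[OF xy, symmetric] distrib_right sum.distrib
        sum_distrib_left sum_distrib_right algebra_simps)
  finally show ?thesis by (simp add: algebra_simps)
qed

lemma L2_DC00:
  assumes xy: "x \<in> X" "y \<noteq> 0"
  shows "(\<Sum>r\<in>UNIV. L2 L i r x y * DC00 r x y)
    = 2 * exp (- s x) * F0 L b i x y - pd i s x * L x y + sigma0 s x y * L1 L i x y"
proof -
  have lin: "(\<Sum>j\<in>UNIV. (c * f j - 1/2 * p j + 1/2 * (d * q j - m j)) * y $ j) = c * (\<Sum>j\<in>UNIV. f j * y $ j)
      - 1/2 * (\<Sum>j\<in>UNIV. p j * y $ j) + 1/2 * (d * (\<Sum>j\<in>UNIV. q j * y $ j) - (\<Sum>j\<in>UNIV. m j * y $ j))"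
    for c d and f p q m :: "'n \<Rightarrow> real"
    by (simp add: algebra_simps sum.distrib sum_subtractf sum_distrib_left sum_divide_distrib)
  define p where "p = (\<Sum>r\<in>UNIV. L2 L i r x y * DC00 r x y)"
  have "p = (\<Sum>j\<in>UNIV. (\<Sum>r\<in>UNIV. L2 L i r x y * DC0 r j x y) * y $ j)"
    unfolding p_def DC00_def sum_distrib_left sum_distrib_right
    by (subst sum.swap) (simp add: mult_ac)
  also have "\<dots> = exp (- s x) * F0 L b i x y
     - 1/2 * (\<Sum>j\<in>UNIV. (\<Sum>r\<in>UNIV. L3 L i j r x y * DC00 r x y) * y $ j)
     + 1/2 * (sigma0 s x y * (\<Sum>j\<in>UNIV. L2 L i j x y * y $ j) - (\<Sum>j\<in>UNIV. mu L s i j x y * y $ j))"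
    unfolding L2_DC0[OF xy] F0_def by (rule lin)
  also have "(\<Sum>j\<in>UNIV. (\<Sum>r\<in>UNIV. L3 L i j r x y * DC00 r x y) * y $ j)
      = (\<Sum>r\<in>UNIV. (\<Sum>j\<in>UNIV. L3 L i r j x y * y $ j) * DC00 r x y)"
    unfolding sum_distrib_left sum_distrib_right
    by (subst sum.swap) (simp add: mult_ac L3_sym[OF xy, of i])
  \<comment> \<open>Here the unknown p returns with coefficient 1/2 on the right; solving for p
    doubles the other terms, whence the factor 2 in front of F_i0.\<close>
  also have "\<dots> = - p"
    by (simp add: L3_y[OF xy] p_def sum_negf)
  also have "(\<Sum>j\<in>UNIV. mu L s i j x y * y $ j) = pd i s x * L x y - sigma0 s x y * L1 L i x y"
    by (simp add: mu_def sigma0_def L1_y[OF xy, symmetric] left_diff_distrib sum_subtractf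
        sum_distrib_left sum_distrib_right algebra_simps)
  also have "(\<Sum>j\<in>UNIV. L2 L i j x y * y $ j) = 0" by (rule L2_y[OF xy])
  finally show ?thesis unfolding p_def[symmetric] by (simp add: field_simps)
qed

text \<open>In \<open>L1_bar_DC0\<close> the unknown on the right occurs only with L_jr, which y
  annihilates. Together with \<open>L2_DC00\<close> this is a system for D^r_00 with explicit
  right-hand sides.\<close>

lemma L1_bar_DC00:
  assumes xy: "x \<in> X" "y \<noteq> 0"
  shows "(\<Sum>r\<in>UNIV. L1 Lb r x y * DC00 r x y) = E00 L b x y + exp (s x) * sigma0 s x y * L x y"
proof -
  have lin: "(\<Sum>j\<in>UNIV. (e j - 1/2 * c * p j + 1/2 * c * (d * q j + m j * l)) * y $ j) = (\<Sum>j\<in>UNIV. e j * y $ j)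
      - 1/2 * c * (\<Sum>j\<in>UNIV. p j * y $ j) + 1/2 * c * (d * (\<Sum>j\<in>UNIV. q j * y $ j) + (\<Sum>j\<in>UNIV. m j * y $ j) * l)"
    for c d l and e p q m :: "'n \<Rightarrow> real"
    by (simp add: algebra_simps sum.distrib sum_subtractf sum_distrib_left sum_divide_distrib)
  have "(\<Sum>r\<in>UNIV. L1 Lb r x y * DC00 r x y) = (\<Sum>j\<in>UNIV. (\<Sum>r\<in>UNIV. L1 Lb r x y * DC0 r j x y) * y $ j)"
    unfolding DC00_def sum_distrib_left sum_distrib_right
    by (subst sum.swap) (simp add: mult_ac)
  also have "\<dots> = (\<Sum>j\<in>UNIV. E0 L b j x y * y $ j)
     - 1/2 * exp (s x) * (\<Sum>j\<in>UNIV. (\<Sum>r\<in>UNIV. L2 L j r x y * DC00 r x y) * y $ j)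
     + 1/2 * exp (s x) * (sigma0 s x y * (\<Sum>j\<in>UNIV. L1 L j x y * y $ j) + (\<Sum>j\<in>UNIV. pd j s x * y $ j) * L x y)"
    unfolding L1_bar_DC0[OF xy] by (rule lin)
  also have "(\<Sum>j\<in>UNIV. E0 L b j x y * y $ j) = E00 L b x y"
    unfolding E00_def E0_def sum_distrib_right by (rule sum.swap)
  also have "(\<Sum>j\<in>UNIV. (\<Sum>r\<in>UNIV. L2 L j r x y * DC00 r x y) * y $ j)
      = (\<Sum>r\<in>UNIV. DC00 r x y * (\<Sum>j\<in>UNIV. L2 L r j x y * y $ j))"
    unfolding sum_distrib_left sum_distrib_right
    by (subst sum.swap) (simp add: mult_ac L2_sym[OF xy])
  finally show ?thesis
    by (simp add: L2_y[OF xy] L1_y[OF xy] sigma0_def[symmetric])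
qed

section \<open>Solving the linear systems\<close>

lemma fund_inv_L1:
  assumes xy: "x \<in> X" "y \<noteq> 0"
  shows "(\<Sum>r\<in>UNIV. fund_inv L i r x y * L1 L r x y) = Lup L i x y"
proof (rule fund_solve[OF xy])
  show "(\<Sum>r\<in>UNIV. fund L i r x y * Lup L r x y) = L1 L i x y" for i
    using fund_y[OF xy, of i] pos[OF xy] by (simp add: Lup_def sum_divide_distrib[symmetric])
qed

text \<open>Since \<open>g\<^sub>i\<^sub>j = L\<^sub>i L\<^sub>j + L L\<^sub>i\<^sub>j\<close>, a vector is determined by its products with
  \<open>L\<^sub>i\<^sub>j\<close>, whose kernel is spanned by \<open>y\<close>, and with the derivative of the changed metric,
  which is positive on \<open>y\<close>.\<close>

lemma beta_change_solve:
  assumes xy: "x \<in> X" "y \<noteq> 0"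
    and a: "\<And>i. (\<Sum>r\<in>UNIV. L2 L i r x y * v r) = a i"
    and c: "(\<Sum>r\<in>UNIV. L1 Lb r x y * v r) = c"
  shows "v i = L x y * (\<Sum>r\<in>UNIV. fund_inv L i r x y * a r)
    + L x y / Lbar L s b x y * (c - L x y * (\<Sum>j\<in>UNIV. b_up L b j x y * a j)) * Lup L i x y"
proof -
  \<comment> \<open>By the splitting of g, lowering v gives L a_i + t L_i; raising the index leaves
    t as the only unknown.\<close>
  define t where "t = (\<Sum>r\<in>UNIV. L1 L r x y * v r)"
  define A where "A = (\<lambda>i. \<Sum>r\<in>UNIV. fund_inv L i r x y * a r)"
  have L0: "L x y > 0" and Lb0: "Lbar L s b x y > 0"
    using pos[OF xy] bar.pos[OF xy] Lb_eq[OF xy(1)] by auto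
  have "(\<Sum>r\<in>UNIV. fund L i r x y * v r) = L x y * a i + t * L1 L i x y" for i
    unfolding fund_eq[OF xy] a[symmetric] t_def
    by (simp add: distrib_right sum.distrib sum_distrib_left algebra_simps)
  from fund_solve[OF xy this] have "v i = L x y * A i + t * (\<Sum>r\<in>UNIV. fund_inv L i r x y * L1 L r x y)" for i
    by (simp add: A_def distrib_left sum.distrib sum_distrib_left algebra_simps)
  then have v: "v i = L x y * A i + t * Lup L i x y" for i
    by (simp add: fund_inv_L1[OF xy])
  have beta: "(\<Sum>j\<in>UNIV. b_up L b j x y * a j) = (\<Sum>j\<in>UNIV. b x $ j * A j)"
    unfolding b_up_def A_def sum_distrib_left sum_distrib_right
    by (subst sum.swap) (simp add: mult_ac fund_inv_sym[OF xy])
  have "c = exp (s x) * t + (\<Sum>r\<in>UNIV. b x $ r * v r)"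
    unfolding c[symmetric] L1_bar[OF xy] t_def
    by (simp add: distrib_right sum.distrib sum_distrib_left algebra_simps)
  also have "(\<Sum>r\<in>UNIV. b x $ r * v r) = L x y * (\<Sum>j\<in>UNIV. b x $ j * A j)
      + t * ((\<Sum>r\<in>UNIV. b x $ r * y $ r) / L x y)"
    unfolding v Lup_def
    by (simp add: distrib_left sum.distrib sum_distrib_left sum_divide_distrib algebra_simps)
  \<comment> \<open>The coefficient of t is e^sigma + \<beta>/L = Lbar/L, which is nonzero.\<close>
  finally have "c - L x y * (\<Sum>j\<in>UNIV. b x $ j * A j) = t * (Lbar L s b x y / L x y)"
    using L0 by (simp add: Lbar_def field_simps)
  then have "t = L x y / Lbar L s b x y * (c - L x y * (\<Sum>j\<in>UNIV. b x $ j * A j))"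
    using L0 Lb0 by simp
  then show ?thesis using v beta by (simp add: A_def)
qed

lemma D00_eq:
  assumes xy: "x \<in> X" "y \<noteq> 0"
  shows "D00 L s b i x y = DC00 i x y"
proof -
  let ?a = "\<lambda>r. 2 * exp (- s x) * F0 L b r x y - pd r s x * L x y + sigma0 s x y * L1 L r x y"
  have L0: "L x y > 0" and Lb0: "Lbar L s b x y > 0"
    using pos[OF xy] bar.pos[OF xy] Lb_eq[OF xy(1)] by auto
  have F0_up: "F0_up L b i x y = (\<Sum>r\<in>UNIV. fund_inv L i r x y * F0 L b r x y)" for i
    by (simp add: F0_up_def fund_inv_sym[OF xy, of i])
  have up: "(\<Sum>r\<in>UNIV. fund_inv L i r x y * ?a r)
      = 2 * exp (- s x) * F0_up L b i x y - L x y * sigma_up L s i x y + sigma0 s x y * Lup L i x y" for i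
    by (simp add: F0_up sigma_up_def fund_inv_L1[OF xy, symmetric] sum.distrib sum_subtractf
        sum_distrib_left algebra_simps)
  have bL: "(\<Sum>j\<in>UNIV. b_up L b j x y * L1 L j x y) = (\<Sum>j\<in>UNIV. b x $ j * y $ j) / L x y"
  proof -
    have "(\<Sum>j\<in>UNIV. b_up L b j x y * L1 L j x y)
        = (\<Sum>j\<in>UNIV. b x $ j * (\<Sum>r\<in>UNIV. fund_inv L j r x y * L1 L r x y))"
      unfolding b_up_def sum_distrib_left sum_distrib_right
      by (subst sum.swap) (simp add: mult_ac fund_inv_sym[OF xy])
    then show ?thesis
      by (simp add: fund_inv_L1[OF xy] Lup_def sum_divide_distrib)
  qed
  have "(\<Sum>j\<in>UNIV. b_up L b j x y * ?a j) = 2 * exp (- s x) * F_beta0 L b x y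
      - L x y * sigma_beta L s b x y + sigma0 s x y * (\<Sum>j\<in>UNIV. b_up L b j x y * L1 L j x y)"
    by (simp add: F_beta0_def sigma_beta_def distrib_left right_diff_distrib sum.distrib sum_subtractf
        sum_distrib_left algebra_simps)
  then have "DC00 i x y = L x y * (2 * exp (- s x) * F0_up L b i x y - L x y * sigma_up L s i x y
      + sigma0 s x y * Lup L i x y)
    + L x y / Lbar L s b x y * (E00 L b x y + exp (s x) * sigma0 s x y * L x y - L x y *
      (2 * exp (- s x) * F_beta0 L b x y - L x y * sigma_beta L s b x y
       + sigma0 s x y * ((\<Sum>j\<in>UNIV. b x $ j * y $ j) / L x y))) * Lup L i x y"
    using beta_change_solve[OF xy L2_DC00[OF xy] L1_bar_DC00[OF xy], of i] up bL by simp
  also have "\<dots> = D00 L s b i x y"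
  proof -
    \<comment> \<open>Substituting \<beta> = Lbar - e^sigma L merges the sigma_0 terms: Lbar +
      e^sigma L - \<beta> = 2 e^sigma L, the origin of 2 L e^sigma sigma_0 in
      \<open>D00\<close>.\<close>
    define B where "B = Lbar L s b x y"
    have b: "(\<Sum>j\<in>UNIV. b x $ j * y $ j) = B - exp (s x) * L x y"
      by (simp add: B_def Lbar_def)
    have "B \<noteq> 0" using Lb0 by (simp add: B_def)
    then show ?thesis
      using L0 unfolding D00_def b B_def[symmetric] by (simp add: field_simps power2_eq_square)
  qed
  finally show ?thesis by simp
qed

lemma D0_eq:
  assumes xy: "x \<in> X" "y \<noteq> 0"
  shows "D0 L s b i j x y = DC0 i j x y"
proof -
  have 1: "(\<Sum>r\<in>UNIV. L2 L i r x y * DC0 r j x y) = G2 L s b i j x y" for i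
    using L2_DC0[OF xy] D00_eq[OF xy] by (simp add: G2_def)
  have 2: "(\<Sum>r\<in>UNIV. L1 Lb r x y * DC0 r j x y) = G1 L s b j x y"
    using L1_bar_DC0[OF xy] D00_eq[OF xy] by (simp add: G1_def)
  show ?thesis
    using beta_change_solve[OF xy 1 2, of i] by (simp add: D0_def G2_up_def G_beta_def)
qed

lemma D_eq:
  assumes xy: "x \<in> X" "y \<noteq> 0"
  shows "D L s b i j k x y = DC i j k x y"
proof -
  have 1: "(\<Sum>r\<in>UNIV. L2 L i r x y * DC r j k x y) = H3 L s b i j k x y" for i
    using L2_DC[OF xy] D0_eq[OF xy] by (simp add: H3_def)
  have 2: "(\<Sum>r\<in>UNIV. L1 Lb r x y * DC r j k x y) = H2 L s b j k x y"
    using L1_bar_DC_sym[OF xy] D0_eq[OF xy] by (simp add: H2_def)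
  show ?thesis
    using beta_change_solve[OF xy 1 2, of i] by (simp add: D_def H3_up_def H_beta_def)
qed

end

section \<open>From the manifold to a chart\<close>

lemma finsler_metric_chart:
  assumes "smooth_atlas A" "finsler_metric A L" "c \<in> A"
  shows "finsler_chart (chart_image c) (local_rep A c L)"
  using assms by (simp add: finsler_chart_def smooth_field_def smooth_atlas_def finsler_metric_def Let_def)

theorem theoremA:
  fixes A :: "('m::{t2_space,second_countable_topology}, 'n::finite) chart set"
    and L \<beta> :: "'m \<Rightarrow> 'm tvec \<Rightarrow> real"
    and \<sigma> :: "'m \<Rightarrow> real"
  assumes "smooth_atlas A"
    and "finsler_metric A L"
    and "smooth_fun A \<sigma>"
    and "one_form A \<beta>"
    and "finsler_metric A (beta_change \<sigma> \<beta> L)"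
    and "c \<in> A" and "x \<in> chart_image c" and "y \<noteq> 0"
  shows "let l = local_rep A c L; lbar = local_rep A c (beta_change \<sigma> \<beta> L);
             s = \<sigma> \<circ> chart_inv c; b = form_comp A c \<beta>
         in (\<forall>i j k. cartan lbar i j k x y = cartan l i j k x y + D l s b i j k x y) \<and>
            (\<forall>i j. D0 l s b i j x y = (\<Sum>k\<in>UNIV. D l s b i k j x y * y $ k)) \<and>
            (\<forall>r. D00 l s b r x y = (\<Sum>j\<in>UNIV. \<Sum>k\<in>UNIV. D l s b r j k x y * y $ j * y $ k))"
proof -
  let ?X = "chart_image c"
  let ?l = "local_rep A c L" and ?lb = "local_rep A c (beta_change \<sigma> \<beta> L)"
  let ?s = "\<sigma> \<circ> chart_inv c" and ?b = "form_comp A c \<beta>"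
  interpret beta_change_chart ?X ?l ?lb ?s ?b
  proof (intro beta_change_chart.intro beta_change_chart_axioms.intro)
    show "finsler_chart ?X ?l" "finsler_chart ?X ?lb"
      using assms by (simp_all add: finsler_metric_chart)
    show "?lb x y = Lbar ?l ?s ?b x y" if "x \<in> ?X" for x y
    proof -
      have "?lb x y = exp (?s x) * ?l x y + local_rep A c \<beta> x y"
        by (simp add: local_rep_def beta_change_def)
      then show ?thesis
        using that assms(4,6) by (simp add: one_form_def Lbar_def)
    qed
    show "?s differentiable at x" if "x \<in> ?X" for x
      using that assms(3,6) by (auto simp: smooth_fun_def intro: smooth_on_differentiable)
    show "(\<lambda>x. ?b x $ i) differentiable at x" if "x \<in> ?X" for x i
    proof -
      have "?b differentiable at x"
        using that assms(4,6) by (auto simp: one_form_def intro: smooth_on_differentiable)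
      then show ?thesis
        unfolding differentiable_def
        by (auto intro: bounded_linear.has_derivative[OF bounded_linear_vec_nth])
    qed
  qed
  note xy = assms(7,8)
  show ?thesis
    \<comment> \<open>Once the explicit expressions are replaced by the true differences, the three
      claims reduce to the definitions of \<open>DC\<close> and \<open>DC0\<close> and to
      \<open>DC00_sum\<close>.\<close>
    unfolding Let_def D_eq[OF xy] D0_eq[OF xy] D00_eq[OF xy]
    by (simp add: DC_def DC0_def DC00_sum)
qed

end
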